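(* Let $G$ be a countable discrete group, $E$ a row-finite graph with no sources, $\sigma$ an action of $G$ on $E$ (written $g\cdot x=\sigma_g(x)$), and $\phi:G\times E^1\to G$ a one-cocycle for the restriction of $\sigma$ to $E^1$ such that $\phi(g,e)\cdot v=g\cdot v$ for all $g\in G$, $e\in E^1$, $v\in E^0$. Let $K$ be a field (with the trivial involution). Suppose that for every $g\in G$ and every $v\in E^0$, there are at most finitely many minimal strongly fixed paths for $g$ with range $v$. The following holds: (1) If $E^0$ is finite and the Exel-Pardo algebra $L_K(G,E)$ is simple, then $Z(L_K(G,E)) = K\cdot 1_{L_K(G,E)}$. (2) If $E^0$ is infinite and $L_K(G,E)$ is simple, then $Z(L_K(G,E)) = 0$.
   Context: A (directed) graph $E=(E^0,E^1,r,s)$ consists of disjoint sets $E^0$ (vertices) and $E^1$ (edges) and maps $s,r:E^1\to E^0$. It is row-finite if $|r^{-1}(v)|<\infty$ for all $v\in E^0$; a source is a vertex $v$ with $r^{-1}(v)=\varnothing$. A path of length $n\ge 1$ is a sequence $p=e_1\cdots e_n$ of edges with $s(e_i)=r(e_{i+1})$; $s(p)=s(e_n)$, $r(p)=r(e_1)$; vertices are paths of length $0$; $E^*$ is the set of all paths. The prefixes of $p$ are $r(p)$ and $e_1\cdots e_i$, $1\le i\le n$. An automorphism of $E$ is a bijection $\sigma$ of $E^0\sqcup E^1$ with $\sigma(E^i)=E^i$ $(i=0,1)$, $r\circ\sigma=\sigma\circ r$, $s\circ\sigma=\sigma\circ s$. An action of $G$ on $E$ is a group homomorphism $g\mapsto\sigma_g$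 from $G$ to the automorphism group of $E$. A one-cocycle for the restricted action on $E^1$ is a map $\phi:G\times E^1\to G$ with $\phi(gh,e)=\phi(g,h\cdot e)\phi(h,e)$ for all $g,h\in G$, $e\in E^1$. $e_G$ denotes the unit of $G$. The action and cocycle extend to $E^*$ by $\phi(g,v)=g$ for $v\in E^0$, $g\cdot(e\alpha)=(g\cdot e)(\phi(g,e)\cdot\alpha)$ and $\phi(g,e\alpha)=\phi(\phi(g,e),\alpha)$ for $e\in E^1$, $\alpha\in E^*$ with $s(e)=r(\alpha)$. A path $\alpha\in E^*$ is strongly fixed by $g\in G$ if $g\cdot\alpha=\alpha$ and $\phi(g,\alpha)=e_G$; if in addition no proper prefix of $\alpha$ is strongly fixed by $g$, then $\alpha$ is a minimal strongly fixed path for $g$. The Exel-Pardo algebra $L_K(G,E)$ is the $*$-algebra over $K$ (not necessarily unital, with $K$-linear involution) generated by $\{P_{v,f}\mid v\in E^0,f\in G\}\cup\{S_{e,g}\mid e\in E^1,g\in G\}$ subject to ($\delta$ the Kronecker delta): (a) writing $p_v=P_{v,e_G}$ and $s_e=S_{e,e_G}$: $p_vp_w=\delta_{v,w}p_w$; $p_{r(e)}s_e=s_e=s_ep_{s(e)}$ and $p_{s(e)}s_e^*=s_e^*=s_e^*p_{r(e)}$; $s_e^*s_f=\delta_{e,f}p_{s(e)}$; $p_v=\sum_{e\in r^{-1}(v)}s_es_e^*$ for every $v$ with $0<|r^{-1}(v)|<\infty$; (b) $(P_{v,f})^*=P_{f^{-1}\cdot v,f^{-1}}$; (c) $P_{v,f}P_{w,h}=\delta_{v,f\cdot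 w}P_{v,fh}$; (d) $P_{v,f}S_{e,g}=\delta_{v,r(f\cdot e)}S_{f\cdot e,\phi(f,e)g}$; (e) $S_{e,g}P_{v,f}=\delta_{g\cdot v,s(e)}S_{e,gf}$. When $E^0$ is finite, $1_{L_K(G,E)}=\sum_{v\in E^0}P_{v,e_G}$ is the identity. $Z(R)$ denotes the center of a ring $R$. *)

theory Defs
  imports
    "HOL-Library.Countable_Set"
    "HOL-Algebra.AbelCoset"
    "HOL-Algebra.Module"
    "HOL-Algebra.Group_Action"
    "Graph_Theory.Digraph"
begin

section \<open>Star-algebras given by generators and relations\<close>

text \<open>
  Algebras over \<open>'k\<close> need not have an identity, so the locales of HOL-Algebra for rings and ideals
  do not apply; only the record type (carrier, operations) is reused. The involution of the
  field is trivial, so the star operation is \<open>'k\<close>-linear.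
\<close>

record ('k, 'a) star_algebra = "('k, 'a) module" +
  star :: "'a \<Rightarrow> 'a"

datatype (dead 'k, generators: 'x) star_term =
    Gen 'x
  | Zero
  | Add "('k, 'x) star_term" "('k, 'x) star_term"
  | Smult 'k "('k, 'x) star_term"
  | Mult "('k, 'x) star_term" "('k, 'x) star_term"
  | Star "('k, 'x) star_term"

definition star_terms :: "'x set \<Rightarrow> ('k, 'x) star_term set" where
  "star_terms X = {t. generators t \<subseteq> X}"

text \<open>The least congruence on the terms over \<open>X\<close> that contains \<open>R\<close> and the laws of
  (not necessarily unital) associative star-algebras over \<open>'k\<close>.\<close>

inductive_set star_congruence ::
    "'x set \<Rightarrow> (('k::field, 'x) star_term \<times> ('k, 'x) star_term) set \<Rightarrow>
     (('k, 'x) star_term \<times> ('k, 'x) star_term) set"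
  for X :: "'x set" and R :: "(('k::field, 'x) star_term \<times> ('k, 'x) star_term) set" where
  relation: "\<lbrakk>(t, u) \<in> R; t \<in> star_terms X; u \<in> star_terms X\<rbrakk> \<Longrightarrow> (t, u) \<in> star_congruence X R"
| refl: "t \<in> star_terms X \<Longrightarrow> (t, t) \<in> star_congruence X R"
| sym: "(t, u) \<in> star_congruence X R \<Longrightarrow> (u, t) \<in> star_congruence X R"
| trans: "\<lbrakk>(t, u) \<in> star_congruence X R; (u, w) \<in> star_congruence X R\<rbrakk>
    \<Longrightarrow> (t, w) \<in> star_congruence X R"
| cong_Add: "\<lbrakk>(t, t') \<in> star_congruence X R; (u, u') \<in> star_congruence X R\<rbrakk>
    \<Longrightarrow> (Add t u, Add t' u') \<in> star_congruence X R"
| cong_Smult: "(t, t') \<in> star_congruence X R \<Longrightarrow> (Smult a t, Smult a t') \<in> star_congruence X R"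
| cong_Mult: "\<lbrakk>(t, t') \<in> star_congruence X R; (u, u') \<in> star_congruence X R\<rbrakk>
    \<Longrightarrow> (Mult t u, Mult t' u') \<in> star_congruence X R"
| cong_Star: "(t, t') \<in> star_congruence X R \<Longrightarrow> (Star t, Star t') \<in> star_congruence X R"
| Add_assoc: "\<lbrakk>t \<in> star_terms X; u \<in> star_terms X; w \<in> star_terms X\<rbrakk>
    \<Longrightarrow> (Add (Add t u) w, Add t (Add u w)) \<in> star_congruence X R"
| Add_commute: "\<lbrakk>t \<in> star_terms X; u \<in> star_terms X\<rbrakk>
    \<Longrightarrow> (Add t u, Add u t) \<in> star_congruence X R"
| Add_Zero: "t \<in> star_terms X \<Longrightarrow> (Add Zero t, t) \<in> star_congruence X R"
| Add_inverse: "t \<in> star_terms X \<Longrightarrow> (Add (Smult (- 1) t) t, Zero) \<in> star_congruence X R"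
| Smult_Add: "\<lbrakk>t \<in> star_terms X; u \<in> star_terms X\<rbrakk>
    \<Longrightarrow> (Smult a (Add t u), Add (Smult a t) (Smult a u)) \<in> star_congruence X R"
| add_Smult: "t \<in> star_terms X
    \<Longrightarrow> (Smult (a + b) t, Add (Smult a t) (Smult b t)) \<in> star_congruence X R"
| mult_Smult: "t \<in> star_terms X \<Longrightarrow> (Smult (a * b) t, Smult a (Smult b t)) \<in> star_congruence X R"
| one_Smult: "t \<in> star_terms X \<Longrightarrow> (Smult 1 t, t) \<in> star_congruence X R"
| Mult_assoc: "\<lbrakk>t \<in> star_terms X; u \<in> star_terms X; w \<in> star_terms X\<rbrakk>
    \<Longrightarrow> (Mult (Mult t u) w, Mult t (Mult u w)) \<in> star_congruence X R"
| Mult_Add: "\<lbrakk>t \<in> star_terms X; u \<in> star_terms X; w \<in> star_terms X\<rbrakk>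
    \<Longrightarrow> (Mult t (Add u w), Add (Mult t u) (Mult t w)) \<in> star_congruence X R"
| Add_Mult: "\<lbrakk>t \<in> star_terms X; u \<in> star_terms X; w \<in> star_terms X\<rbrakk>
    \<Longrightarrow> (Mult (Add t u) w, Add (Mult t w) (Mult u w)) \<in> star_congruence X R"
| Smult_Mult: "\<lbrakk>t \<in> star_terms X; u \<in> star_terms X\<rbrakk>
    \<Longrightarrow> (Mult (Smult a t) u, Smult a (Mult t u)) \<in> star_congruence X R"
| Mult_Smult: "\<lbrakk>t \<in> star_terms X; u \<in> star_terms X\<rbrakk>
    \<Longrightarrow> (Mult t (Smult a u), Smult a (Mult t u)) \<in> star_congruence X R"
| Star_Add: "\<lbrakk>t \<in> star_terms X; u \<in> star_terms X\<rbrakk>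
    \<Longrightarrow> (Star (Add t u), Add (Star t) (Star u)) \<in> star_congruence X R"
| Star_Smult: "t \<in> star_terms X \<Longrightarrow> (Star (Smult a t), Smult a (Star t)) \<in> star_congruence X R"
| Star_Mult: "\<lbrakk>t \<in> star_terms X; u \<in> star_terms X\<rbrakk>
    \<Longrightarrow> (Star (Mult t u), Mult (Star u) (Star t)) \<in> star_congruence X R"
| Star_Star: "t \<in> star_terms X \<Longrightarrow> (Star (Star t), t) \<in> star_congruence X R"

text \<open>The star-algebra generated by \<open>X\<close> subject to \<open>R\<close>. The field \<open>one\<close> of the record is
  meaningful only if the algebra happens to have an identity.\<close>

definition presented_star_algebra ::
    "'x set \<Rightarrow> (('k::field, 'x) star_term \<times> ('k, 'x) star_term) set \<Rightarrow>
     ('k, ('k, 'x) star_term set) star_algebra" where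
  "presented_star_algebra X R =
    (let \<Theta> = star_congruence X R;
         C = star_terms X // \<Theta>;
         m = (\<lambda>A B. \<Union>t\<in>A. \<Union>u\<in>B. \<Theta> `` {Mult t u})
     in \<lparr>carrier = C,
         mult = m,
         one = (THE i. i \<in> C \<and> (\<forall>A\<in>C. m i A = A \<and> m A i = A)),
         zero = \<Theta> `` {Zero},
         add = (\<lambda>A B. \<Union>t\<in>A. \<Union>u\<in>B. \<Theta> `` {Add t u}),
         smult = (\<lambda>a A. \<Union>t\<in>A. \<Theta> `` {Smult a t}),
         star = (\<lambda>A. \<Union>t\<in>A. \<Theta> `` {Star t})\<rparr>)"

section \<open>Center and simplicity\<close>

definition center :: "('a, 'm) ring_scheme \<Rightarrow> 'a set" where
  "center A = {z \<in> carrier A. \<forall>x\<in>carrier A. z \<otimes>\<^bsub>A\<^esub> x = x \<otimes>\<^bsub>A\<^esub> z}"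

text \<open>Ideals are required to be \<open>'k\<close>-subspaces. In an algebra with local units, such as the
  Exel-Pardo algebra, every ring ideal has this property.\<close>

definition two_sided_ideal :: "'a set \<Rightarrow> ('k, 'a, 'm) module_scheme \<Rightarrow> bool" where
  "two_sided_ideal I A \<longleftrightarrow> additive_subgroup I A \<and>
     (\<forall>a. \<forall>x\<in>I. a \<odot>\<^bsub>A\<^esub> x \<in> I) \<and>
     (\<forall>x\<in>I. \<forall>y\<in>carrier A. x \<otimes>\<^bsub>A\<^esub> y \<in> I \<and> y \<otimes>\<^bsub>A\<^esub> x \<in> I)"

definition simple_algebra :: "('k, 'a, 'm) module_scheme \<Rightarrow> bool" where
  "simple_algebra A \<longleftrightarrow>
     (\<exists>x\<in>carrier A. \<exists>y\<in>carrier A. x \<otimes>\<^bsub>A\<^esub> y \<noteq> \<zero>\<^bsub>A\<^esub>) \<and>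
     (\<forall>I. two_sided_ideal I A \<longrightarrow> I = {\<zero>\<^bsub>A\<^esub>} \<or> I = carrier A)"

section \<open>Actions on graphs and one-cocycles\<close>

text \<open>
  A graph is a digraph \<open>E\<close> with \<open>s = tail E\<close> and \<open>r = head E\<close>; the set \<open>in_arcs E v\<close> is the
  preimage of \<open>v\<close> under \<open>r\<close>. A bijection of the disjoint union of vertices and edges that preserves
  both sets is the same as a pair of bijections, so an action of \<open>G\<close> consists
  of an action \<open>av\<close> on the vertices and an action \<open>ae\<close> on the edges that commute with
  \<open>r\<close> and \<open>s\<close>.
\<close>

definition row_finite :: "('v, 'e) pre_digraph \<Rightarrow> bool" where
  "row_finite E \<longleftrightarrow> (\<forall>v\<in>verts E. finite (in_arcs E v))"

definition no_sources :: "('v, 'e) pre_digraph \<Rightarrow> bool" where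
  "no_sources E \<longleftrightarrow> (\<forall>v\<in>verts E. in_arcs E v \<noteq> {})"

locale graph_action =
  group G + wf_digraph E + vertex_action: group_action G "verts E" av +
  edge_action: group_action G "arcs E" ae
  for G :: "('g, 'm) monoid_scheme" (structure) and E :: "('v, 'e) pre_digraph"
    and av :: "'g \<Rightarrow> 'v \<Rightarrow> 'v" and ae :: "'g \<Rightarrow> 'e \<Rightarrow> 'e" +
  assumes head_equivariant:
      "\<And>g e. \<lbrakk>g \<in> carrier G; e \<in> arcs E\<rbrakk> \<Longrightarrow> head E (ae g e) = av g (head E e)"
    and tail_equivariant:
      "\<And>g e. \<lbrakk>g \<in> carrier G; e \<in> arcs E\<rbrakk> \<Longrightarrow> tail E (ae g e) = av g (tail E e)"

definition one_cocycle ::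
    "('g, 'm) monoid_scheme \<Rightarrow> 'e set \<Rightarrow> ('g \<Rightarrow> 'e \<Rightarrow> 'e) \<Rightarrow> ('g \<Rightarrow> 'e \<Rightarrow> 'g) \<Rightarrow> bool" where
  "one_cocycle G D ae \<phi> \<longleftrightarrow>
     \<phi> \<in> carrier G \<rightarrow> D \<rightarrow> carrier G \<and>
     (\<forall>g\<in>carrier G. \<forall>h\<in>carrier G. \<forall>e\<in>D.
        \<phi> (g \<otimes>\<^bsub>G\<^esub> h) e = \<phi> g (ae h e) \<otimes>\<^bsub>G\<^esub> \<phi> h e)"

section \<open>Paths\<close>

text \<open>A path is a pair of its range and its list of edges; \<open>(v, [])\<close> is the vertex
  \<open>v\<close>. The prefixes of \<open>(v, es)\<close> are the pairs \<open>(v, take i es)\<close>.\<close>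

definition paths :: "('v, 'e) pre_digraph \<Rightarrow> ('v \<times> 'e list) set" where
  "paths E = {(v, es). v \<in> verts E \<and> set es \<subseteq> arcs E \<and>
     (es \<noteq> [] \<longrightarrow> head E (hd es) = v) \<and>
     (\<forall>i. Suc i < length es \<longrightarrow> tail E (es ! i) = head E (es ! Suc i))}"

fun act_edges :: "('g \<Rightarrow> 'e \<Rightarrow> 'e) \<Rightarrow> ('g \<Rightarrow> 'e \<Rightarrow> 'g) \<Rightarrow> 'g \<Rightarrow> 'e list \<Rightarrow> 'e list" where
  "act_edges ae \<phi> g [] = []"
| "act_edges ae \<phi> g (e # es) = ae g e # act_edges ae \<phi> (\<phi> g e) es"

fun cocycle_edges :: "('g \<Rightarrow> 'e \<Rightarrow> 'g) \<Rightarrow> 'g \<Rightarrow> 'e list \<Rightarrow> 'g" where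
  "cocycle_edges \<phi> g [] = g"
| "cocycle_edges \<phi> g (e # es) = cocycle_edges \<phi> (\<phi> g e) es"

definition act_path ::
    "('g \<Rightarrow> 'v \<Rightarrow> 'v) \<Rightarrow> ('g \<Rightarrow> 'e \<Rightarrow> 'e) \<Rightarrow> ('g \<Rightarrow> 'e \<Rightarrow> 'g) \<Rightarrow>
     'g \<Rightarrow> 'v \<times> 'e list \<Rightarrow> 'v \<times> 'e list" where
  "act_path av ae \<phi> g p = (av g (fst p), act_edges ae \<phi> g (snd p))"

definition strongly_fixed ::
    "('g, 'm) monoid_scheme \<Rightarrow> ('v, 'e) pre_digraph \<Rightarrow> ('g \<Rightarrow> 'v \<Rightarrow> 'v) \<Rightarrow> ('g \<Rightarrow> 'e \<Rightarrow> 'e) \<Rightarrow>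
     ('g \<Rightarrow> 'e \<Rightarrow> 'g) \<Rightarrow> 'g \<Rightarrow> 'v \<times> 'e list \<Rightarrow> bool" where
  "strongly_fixed G E av ae \<phi> g p \<longleftrightarrow>
     p \<in> paths E \<and> act_path av ae \<phi> g p = p \<and> cocycle_edges \<phi> g (snd p) = \<one>\<^bsub>G\<^esub>"

definition minimal_strongly_fixed ::
    "('g, 'm) monoid_scheme \<Rightarrow> ('v, 'e) pre_digraph \<Rightarrow> ('g \<Rightarrow> 'v \<Rightarrow> 'v) \<Rightarrow> ('g \<Rightarrow> 'e \<Rightarrow> 'e) \<Rightarrow>
     ('g \<Rightarrow> 'e \<Rightarrow> 'g) \<Rightarrow> 'g \<Rightarrow> 'v \<times> 'e list \<Rightarrow> bool" where
  "minimal_strongly_fixed G E av ae \<phi> g p \<longleftrightarrow>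
     strongly_fixed G E av ae \<phi> g p \<and>
     (\<forall>i<length (snd p). \<not> strongly_fixed G E av ae \<phi> g (fst p, take i (snd p)))"

section \<open>The Exel-Pardo algebra\<close>

datatype ('v, 'e, 'g) ep_generator = GenP 'v 'g | GenS 'e 'g

type_synonym ('k, 'v, 'e, 'g) ep_term = "('k, ('v, 'e, 'g) ep_generator) star_term"
type_synonym ('k, 'v, 'e, 'g) ep_algebra = "('k, ('k, 'v, 'e, 'g) ep_term set) star_algebra"

definition ep_generators ::
    "('g, 'm) monoid_scheme \<Rightarrow> ('v, 'e) pre_digraph \<Rightarrow> ('v, 'e, 'g) ep_generator set" where
  "ep_generators G E =
     {GenP v f | v f. v \<in> verts E \<and> f \<in> carrier G} \<union>
     {GenS e g | e g. e \<in> arcs E \<and> g \<in> carrier G}"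

abbreviation P_term :: "'v \<Rightarrow> 'g \<Rightarrow> ('k, 'v, 'e, 'g) ep_term" where
  "P_term v f \<equiv> Gen (GenP v f)"

abbreviation S_term :: "'e \<Rightarrow> 'g \<Rightarrow> ('k, 'v, 'e, 'g) ep_term" where
  "S_term e g \<equiv> Gen (GenS e g)"

text \<open>In \<open>sum_v\<close> the sum over \<open>in_arcs E v\<close> is written out for every enumeration of this set,
  which imposes nothing if the set is infinite.\<close>

inductive_set ep_relations ::
    "('g, 'm) monoid_scheme \<Rightarrow> ('v, 'e) pre_digraph \<Rightarrow> ('g \<Rightarrow> 'v \<Rightarrow> 'v) \<Rightarrow> ('g \<Rightarrow> 'e \<Rightarrow> 'e) \<Rightarrow>
     ('g \<Rightarrow> 'e \<Rightarrow> 'g) \<Rightarrow> (('k, 'v, 'e, 'g) ep_term \<times> ('k, 'v, 'e, 'g) ep_term) set"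
  for G :: "('g, 'm) monoid_scheme" (structure) and E :: "('v, 'e) pre_digraph"
    and av :: "'g \<Rightarrow> 'v \<Rightarrow> 'v" and ae :: "'g \<Rightarrow> 'e \<Rightarrow> 'e" and \<phi> :: "'g \<Rightarrow> 'e \<Rightarrow> 'g" where
  pp: "\<lbrakk>v \<in> verts E; w \<in> verts E\<rbrakk> \<Longrightarrow>
    (Mult (P_term v \<one>) (P_term w \<one>), if v = w then P_term w \<one> else Zero)
      \<in> ep_relations G E av ae \<phi>"
| ps: "e \<in> arcs E \<Longrightarrow>
    (Mult (P_term (head E e) \<one>) (S_term e \<one>), S_term e \<one>) \<in> ep_relations G E av ae \<phi>"
| sp: "e \<in> arcs E \<Longrightarrow>
    (Mult (S_term e \<one>) (P_term (tail E e) \<one>), S_term e \<one>) \<in> ep_relations G E av ae \<phi>"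
| ps_star: "e \<in> arcs E \<Longrightarrow>
    (Mult (P_term (tail E e) \<one>) (Star (S_term e \<one>)), Star (S_term e \<one>))
      \<in> ep_relations G E av ae \<phi>"
| s_star_p: "e \<in> arcs E \<Longrightarrow>
    (Mult (Star (S_term e \<one>)) (P_term (head E e) \<one>), Star (S_term e \<one>))
      \<in> ep_relations G E av ae \<phi>"
| s_star_s: "\<lbrakk>e \<in> arcs E; f \<in> arcs E\<rbrakk> \<Longrightarrow>
    (Mult (Star (S_term e \<one>)) (S_term f \<one>), if e = f then P_term (tail E e) \<one> else Zero)
      \<in> ep_relations G E av ae \<phi>"
| sum_v: "\<lbrakk>v \<in> verts E; es \<noteq> []; distinct es; set es = in_arcs E v\<rbrakk> \<Longrightarrow>
    (P_term v \<one>, foldr (\<lambda>e t. Add (Mult (S_term e \<one>) (Star (S_term e \<one>))) t) es Zero)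
      \<in> ep_relations G E av ae \<phi>"
| P_star: "\<lbrakk>v \<in> verts E; f \<in> carrier G\<rbrakk> \<Longrightarrow>
    (Star (P_term v f), P_term (av (inv f) v) (inv f)) \<in> ep_relations G E av ae \<phi>"
| PP: "\<lbrakk>v \<in> verts E; w \<in> verts E; f \<in> carrier G; h \<in> carrier G\<rbrakk> \<Longrightarrow>
    (Mult (P_term v f) (P_term w h), if v = av f w then P_term v (f \<otimes> h) else Zero)
      \<in> ep_relations G E av ae \<phi>"
| PS: "\<lbrakk>v \<in> verts E; e \<in> arcs E; f \<in> carrier G; g \<in> carrier G\<rbrakk> \<Longrightarrow>
    (Mult (P_term v f) (S_term e g),
     if v = head E (ae f e) then S_term (ae f e) (\<phi> f e \<otimes> g) else Zero)
      \<in> ep_relations G E av ae \<phi>"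
| SP: "\<lbrakk>v \<in> verts E; e \<in> arcs E; f \<in> carrier G; g \<in> carrier G\<rbrakk> \<Longrightarrow>
    (Mult (S_term e g) (P_term v f), if av g v = tail E e then S_term e (g \<otimes> f) else Zero)
      \<in> ep_relations G E av ae \<phi>"

definition exel_pardo_algebra ::
    "('g, 'm) monoid_scheme \<Rightarrow> ('v, 'e) pre_digraph \<Rightarrow> ('g \<Rightarrow> 'v \<Rightarrow> 'v) \<Rightarrow> ('g \<Rightarrow> 'e \<Rightarrow> 'e) \<Rightarrow>
     ('g \<Rightarrow> 'e \<Rightarrow> 'g) \<Rightarrow> ('k::field, 'v, 'e, 'g) ep_algebra" where
  "exel_pardo_algebra G E av ae \<phi> =
     presented_star_algebra (ep_generators G E) (ep_relations G E av ae \<phi>)"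

definition ep_P ::
    "('g, 'm) monoid_scheme \<Rightarrow> ('v, 'e) pre_digraph \<Rightarrow> ('g \<Rightarrow> 'v \<Rightarrow> 'v) \<Rightarrow> ('g \<Rightarrow> 'e \<Rightarrow> 'e) \<Rightarrow>
     ('g \<Rightarrow> 'e \<Rightarrow> 'g) \<Rightarrow> 'v \<Rightarrow> 'g \<Rightarrow> ('k::field, 'v, 'e, 'g) ep_term set" where
  "ep_P G E av ae \<phi> v f =
     star_congruence (ep_generators G E) (ep_relations G E av ae \<phi>) `` {P_term v f}"

text \<open>The identity of the Exel-Pardo algebra of a graph with finitely many vertices.\<close>

definition ep_one ::
    "('g, 'm) monoid_scheme \<Rightarrow> ('v, 'e) pre_digraph \<Rightarrow> ('g \<Rightarrow> 'v \<Rightarrow> 'v) \<Rightarrow> ('g \<Rightarrow> 'e \<Rightarrow> 'e) \<Rightarrow>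
     ('g \<Rightarrow> 'e \<Rightarrow> 'g) \<Rightarrow> ('k::field, 'v, 'e, 'g) ep_term set" where
  "ep_one G E av ae \<phi> =
     (\<Oplus>\<^bsub>exel_pardo_algebra G E av ae \<phi>\<^esub>v\<in>verts E. ep_P G E av ae \<phi> v \<one>\<^bsub>G\<^esub>)"

end

theory Submission
  imports Defs
begin

text \<open>
  Functions on the infinite paths of \<open>E\<close> carry a representation of the Exel-Pardo algebra: \<open>S\<^bsub>e,g\<^esub>\<close>
  maps the point mass at \<open>y\<close> to the point mass at \<open>e(g \<cdot> y)\<close>, and \<open>P\<^bsub>v,g\<^esub>\<close> maps it to the point mass at
  \<open>g \<cdot> y\<close> if this path has range \<open>v\<close> (\<open>operator_respects_ep_congruence\<close>). Since every vertex is
  the range of an infinite path, no \<open>p\<^sub>v\<close> acts as zero, so the kernel is a proper ideal. If the algebra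
  is simple, the representation is therefore faithful (\<open>representation_faithful\<close>), and the whole
  question can be settled for operators.

  Every operator of the algebra is a linear combination of operators induced by continuous partial
  maps \<open>\<theta>\<close> with open and closed domains. Any cylinder set contains a smaller one on which \<open>\<theta>\<close> is the
  identity, or which \<open>\<theta>\<close> moves off itself: a point with \<open>\<theta> x \<noteq> x\<close> has such a neighbourhood. So
  below every cylinder there is another cylinder \<open>C\<close> on which a given operator, compressed to \<open>C\<close>, is
  multiplication by a scalar \<open>c\<close> (\<open>local_operator_scalar_on_cylinder\<close>).

  Let \<open>z\<close> be central and apply this to \<open>z\<close>. With \<open>q = s\<^sub>\<alpha> s\<^sub>\<alpha>\<^sup>*\<close> the projection onto \<open>C\<close>,
  centrality gives \<open>z q = q z q = c q\<close>. But \<open>{a. z a = c a}\<close> is a two-sided ideal, again because \<open>z\<close>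
  is central; it contains \<open>q \<noteq> 0\<close> and is everything by simplicity (\<open>central_acts_as_scalar\<close>).

  If there are finitely many vertices, this yields \<open>z = c \<cdot> 1\<close>. If there are infinitely many, then \<open>z\<close>
  annihilates all but finitely many \<open>p\<^sub>v\<close> (\<open>operator_finite_source\<close>); as \<open>z p\<^sub>v = c p\<^sub>v\<close> and
  \<open>p\<^sub>v \<noteq> 0\<close>, this forces \<open>c = 0\<close>. Finite sums of the \<open>p\<^sub>v\<close> are local units,
  so \<open>z = 0\<close>.
\<close>

section \<open>Star-algebras given by generators and relations\<close>

definition term_class ::
    "'x set \<Rightarrow> (('k::field, 'x) star_term \<times> ('k, 'x) star_term) set \<Rightarrow>
     ('k, 'x) star_term \<Rightarrow> ('k, 'x) star_term set" where
  "term_class X R t = star_congruence X R `` {t}"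

lemma star_terms_simps [simp]:
  "Gen x \<in> star_terms X \<longleftrightarrow> x \<in> X"
  "Zero \<in> star_terms X"
  "Add t u \<in> star_terms X \<longleftrightarrow> t \<in> star_terms X \<and> u \<in> star_terms X"
  "Smult a t \<in> star_terms X \<longleftrightarrow> t \<in> star_terms X"
  "Mult t u \<in> star_terms X \<longleftrightarrow> t \<in> star_terms X \<and> u \<in> star_terms X"
  "Star t \<in> star_terms X \<longleftrightarrow> t \<in> star_terms X"
  by (auto simp: star_terms_def)

lemma star_congruence_in_star_terms:
  assumes "(t, u) \<in> star_congruence X R"
  shows "t \<in> star_terms X \<and> u \<in> star_terms X"
  using assms by induction auto

lemma equiv_star_congruence: "equiv (star_terms X) (star_congruence X R)"
proof (rule equivI)
  show "star_congruence X R \<subseteq> star_terms X \<times> star_terms X"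
    using star_congruence_in_star_terms by fastforce
  show "refl_on (star_terms X) (star_congruence X R)"
    by (auto intro: refl_onI star_congruence.refl dest: star_congruence_in_star_terms)
  show "sym (star_congruence X R)"
    by (auto intro: symI star_congruence.sym)
  show "trans (star_congruence X R)"
    by (auto intro: transI star_congruence.trans)
qed

lemma term_class_eq_iff:
  assumes "t \<in> star_terms X" "u \<in> star_terms X"
  shows "term_class X R t = term_class X R u \<longleftrightarrow> (t, u) \<in> star_congruence X R"
  unfolding term_class_def using eq_equiv_class_iff[OF equiv_star_congruence assms] .

lemma carrier_presented [simp]:
  "carrier (presented_star_algebra X R) = term_class X R ` star_terms X"
  by (auto simp: presented_star_algebra_def Let_def quotient_def term_class_def)

lemma zero_presented [simp]:
  "\<zero>\<^bsub>presented_star_algebra X R\<^esub> = term_class X R Zero"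
  by (simp add: presented_star_algebra_def Let_def term_class_def)

lemma mult_presented [simp]:
  assumes "t \<in> star_terms X" "u \<in> star_terms X"
  shows "term_class X R t \<otimes>\<^bsub>presented_star_algebra X R\<^esub> term_class X R u =
    term_class X R (Mult t u)"
proof -
  have "(\<lambda>t u. term_class X R (Mult t u)) respects2 star_congruence X R"
    unfolding term_class_def
    by (intro congruent2I' equiv_class_eq[OF equiv_star_congruence] star_congruence.cong_Mult)
  then show ?thesis
    using UN_equiv_class2[OF equiv_star_congruence equiv_star_congruence _ assms]
    by (simp add: presented_star_algebra_def Let_def term_class_def)
qed

lemma add_presented [simp]:
  assumes "t \<in> star_terms X" "u \<in> star_terms X"
  shows "term_class X R t \<oplus>\<^bsub>presented_star_algebra X R\<^esub> term_class X R u =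
    term_class X R (Add t u)"
proof -
  have "(\<lambda>t u. term_class X R (Add t u)) respects2 star_congruence X R"
    unfolding term_class_def
    by (intro congruent2I' equiv_class_eq[OF equiv_star_congruence] star_congruence.cong_Add)
  then show ?thesis
    using UN_equiv_class2[OF equiv_star_congruence equiv_star_congruence _ assms]
    by (simp add: presented_star_algebra_def Let_def term_class_def)
qed

lemma smult_presented [simp]:
  assumes "t \<in> star_terms X"
  shows "a \<odot>\<^bsub>presented_star_algebra X R\<^esub> term_class X R t = term_class X R (Smult a t)"
proof -
  have "(\<lambda>t. term_class X R (Smult a t)) respects star_congruence X R"
    unfolding term_class_def
    by (intro congruentI equiv_class_eq[OF equiv_star_congruence] star_congruence.cong_Smult)
  then show ?thesis
    using UN_equiv_class[OF equiv_star_congruence _ assms]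
    by (simp add: presented_star_algebra_def Let_def term_class_def)
qed

lemma abelian_group_presented: "abelian_group (presented_star_algebra X R)"
proof (rule abelian_groupI)
  fix x
  assume "x \<in> carrier (presented_star_algebra X R)"
  then obtain t where t: "t \<in> star_terms X" "x = term_class X R t"
    by auto
  then show "\<exists>y\<in>carrier (presented_star_algebra X R).
      y \<oplus>\<^bsub>presented_star_algebra X R\<^esub> x = \<zero>\<^bsub>presented_star_algebra X R\<^esub>"
    by (intro bexI[of _ "term_class X R (Smult (- 1) t)"])
      (auto simp: term_class_eq_iff intro: star_congruence.Add_inverse)
qed (clarsimp simp: term_class_eq_iff;
    auto intro: star_congruence.Add_assoc star_congruence.Add_commute star_congruence.Add_Zero)+

lemma uminus_presented:
  assumes "t \<in> star_terms X"
  shows "\<ominus>\<^bsub>presented_star_algebra X R\<^esub> term_class X R t = term_class X R (Smult (- 1) t)"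
  using assms
  by (intro abelian_group.minus_equality[OF abelian_group_presented])
    (auto simp: term_class_eq_iff intro: star_congruence.Add_inverse)

text \<open>This lets ideals of the quotient be handled as sets of terms; \<open>J\<close> may contain only some representatives of a
  class.\<close>

lemma two_sided_ideal_term_classes:
  assumes sub: "J \<subseteq> star_terms X" and zero: "Zero \<in> J"
    and add: "\<And>t u. \<lbrakk>t \<in> J; u \<in> J\<rbrakk> \<Longrightarrow> Add t u \<in> J"
    and smult: "\<And>a t. t \<in> J \<Longrightarrow> Smult a t \<in> J"
    and mult: "\<And>t u. \<lbrakk>t \<in> J; u \<in> star_terms X\<rbrakk> \<Longrightarrow> Mult t u \<in> J \<and> Mult u t \<in> J"
  shows "two_sided_ideal (term_class X R ` J) (presented_star_algebra X R)"
proof -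
  let ?L = "presented_star_algebra X R"
  interpret abelian_group ?L
    by (rule abelian_group_presented)
  have "subgroup (term_class X R ` J) (add_monoid ?L)"
  proof (rule subgroup.intro)
    fix x assume "x \<in> term_class X R ` J"
    then show "inv\<^bsub>add_monoid ?L\<^esub> x \<in> term_class X R ` J"
      using sub smult uminus_presented by (fold a_inv_def) fastforce
  next
    fix x y assume "x \<in> term_class X R ` J" "y \<in> term_class X R ` J"
    then obtain t u where "t \<in> J" "u \<in> J" "x = term_class X R t" "y = term_class X R u"
      by blast
    with sub add[of t u] show "x \<otimes>\<^bsub>add_monoid ?L\<^esub> y \<in> term_class X R ` J"
      by (auto simp: subset_iff)
  qed (use sub zero in auto)
  moreover have "a \<odot>\<^bsub>?L\<^esub> x \<in> term_class X R ` J" if "x \<in> term_class X R ` J" for a x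
  proof -
    obtain t where "t \<in> J" "x = term_class X R t"
      using \<open>x \<in> term_class X R ` J\<close> by blast
    with sub smult[of t a] show ?thesis
      by (auto simp: subset_iff)
  qed
  moreover have "x \<otimes>\<^bsub>?L\<^esub> y \<in> term_class X R ` J \<and> y \<otimes>\<^bsub>?L\<^esub> x \<in> term_class X R ` J"
    if xy: "x \<in> term_class X R ` J" "y \<in> carrier ?L" for x y
  proof -
    obtain t u where "t \<in> J" "u \<in> star_terms X" "x = term_class X R t" "y = term_class X R u"
      using xy by auto
    with sub mult[of t u] show ?thesis
      by (auto simp: subset_iff)
  qed
  ultimately show ?thesis
    unfolding two_sided_ideal_def additive_subgroup_def by blast
qed

text \<open>Without generators all terms are built from \<open>Zero\<close>, so the algebra vanishes.\<close>

lemma star_congruence_Zero: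
  assumes "t \<in> star_terms {}"
  shows "(t, Zero) \<in> star_congruence {} R"
proof -
  note [trans] = star_congruence.trans
  have Smult_0: "(Smult 0 u, Zero) \<in> star_congruence {} R" if u: "u \<in> star_terms {}" for u
  proof -
    have "(Smult 0 u, Add (Smult (- 1) u) (Smult 1 u)) \<in> star_congruence {} R"
      using star_congruence.add_Smult[OF u, of "- 1" 1] by simp
    also have "(Add (Smult (- 1) u) (Smult 1 u), Add (Smult (- 1) u) u) \<in> star_congruence {} R"
      using u by (intro star_congruence.cong_Add star_congruence.one_Smult)
        (auto intro: star_congruence.refl)
    also have "(Add (Smult (- 1) u) u, Zero) \<in> star_congruence {} R"
      using u by (rule star_congruence.Add_inverse)
    finally show ?thesis .
  qed
  have Zero_Smult: "(Zero, Smult 0 Zero) \<in> star_congruence {} R"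
    using Smult_0 by (auto intro: star_congruence.sym)
  show ?thesis
    using assms
  proof (induction t)
    case (Gen x)
    then show ?case by simp
  next
    case Zero
    show ?case by (auto intro: star_congruence.refl)
  next
    case (Add t u)
    then have "(Add t u, Add Zero Zero) \<in> star_congruence {} R"
      by (auto intro: star_congruence.cong_Add)
    also have "(Add Zero Zero, Zero) \<in> star_congruence {} R"
      by (auto intro: star_congruence.Add_Zero)
    finally show ?case .
  next
    case (Smult a t)
    then have "(t, Smult 0 Zero) \<in> star_congruence {} R"
      using Zero_Smult by (auto intro: star_congruence.trans)
    then have "(Smult a t, Smult a (Smult 0 Zero)) \<in> star_congruence {} R"
      by (rule star_congruence.cong_Smult)
    also have "(Smult a (Smult 0 Zero), Smult (a * 0) Zero) \<in> star_congruence {} R"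
      by (intro star_congruence.sym[OF star_congruence.mult_Smult]) simp
    also have "(Smult (a * 0) Zero, Zero) \<in> star_congruence {} R"
      using Smult_0[of Zero] by simp
    finally show ?case .
  next
    case (Mult t u)
    then have "(Mult t u, Mult (Smult 0 Zero) Zero) \<in> star_congruence {} R"
      using Zero_Smult
      by (intro star_congruence.cong_Mult) (auto intro: star_congruence.trans)
    also have "(Mult (Smult 0 Zero) Zero, Smult 0 (Mult Zero Zero)) \<in> star_congruence {} R"
      by (auto intro: star_congruence.Smult_Mult)
    also have "(Smult 0 (Mult Zero Zero), Zero) \<in> star_congruence {} R"
      by (rule Smult_0) simp
    finally show ?case .
  next
    case (Star t)
    then have "(Star t, Star (Smult 0 Zero)) \<in> star_congruence {} R"
      using Zero_Smult
      by (intro star_congruence.cong_Star) (auto intro: star_congruence.trans)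
    also have "(Star (Smult 0 Zero), Smult 0 (Star Zero)) \<in> star_congruence {} R"
      by (auto intro: star_congruence.Star_Smult)
    also have "(Smult 0 (Star Zero), Zero) \<in> star_congruence {} R"
      by (rule Smult_0) simp
    finally show ?case .
  qed
qed

section \<open>Operators given by partial maps\<close>

definition pullback :: "('y \<Rightarrow> 'y option) \<Rightarrow> ('y \<Rightarrow> 'k::zero) \<Rightarrow> 'y \<Rightarrow> 'k" where
  "pullback \<theta> f x = (case \<theta> x of None \<Rightarrow> 0 | Some y \<Rightarrow> f y)"

text \<open>
  The star of an operator is not a function of the operator alone, so a term is evaluated twice:
  \<open>eval D True t\<close> is the operator of \<open>t\<close> and \<open>eval D False t\<close> is its transpose. Accordingly
  \<open>D True x\<close> and \<open>D False x\<close> are meant to be mutually inverse partial maps.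
\<close>

fun eval :: "(bool \<Rightarrow> 'x \<Rightarrow> 'y \<Rightarrow> 'y option) \<Rightarrow> bool \<Rightarrow> ('k::field, 'x) star_term \<Rightarrow>
    ('y \<Rightarrow> 'k) \<Rightarrow> 'y \<Rightarrow> 'k" where
  "eval D b (Gen x) f = pullback (D b x) f"
| "eval D b Zero f = (\<lambda>_. 0)"
| "eval D b (Add t u) f = (\<lambda>y. eval D b t f y + eval D b u f y)"
| "eval D b (Smult a t) f = (\<lambda>y. a * eval D b t f y)"
| "eval D b (Mult t u) f =
    (if b then eval D b t (eval D b u f) else eval D b u (eval D b t f))"
| "eval D b (Star t) f = eval D (\<not> b) t f"

lemma eval_add: "eval D b t (\<lambda>y. f y + g y) = (\<lambda>y. eval D b t f y + eval D b t g y)"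
proof (induction t arbitrary: b f g)
  case (Gen x)
  then show ?case
    by (auto simp: fun_eq_iff pullback_def split: option.splits)
qed (simp_all add: algebra_simps)

lemma eval_scale: "eval D b t (\<lambda>y. a * f y) = (\<lambda>y. a * eval D b t f y)"
proof (induction t arbitrary: b f)
  case (Gen x)
  then show ?case
    by (auto simp: fun_eq_iff pullback_def split: option.splits)
qed (simp_all add: algebra_simps)

lemma eval_zero: "eval D b t (\<lambda>_. 0) = (\<lambda>_. 0)"
  using eval_scale[of D b t 0 "\<lambda>_. 0"] by simp

text \<open>Pairs of a linear operator and a transpose form a star-algebra when the star swaps the two components and
  the second components multiply in the opposite order.\<close>

lemma eval_respects_star_congruence:
  assumes "(t, u) \<in> star_congruence X R"
    and "\<And>t u b. \<lbrakk>(t, u) \<in> R; t \<in> star_terms X; u \<in> star_terms X\<rbrakk> \<Longrightarrow> eval D b t = eval D b u"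
  shows "eval D b t = eval D b u"
  using assms(1)
proof (induction arbitrary: b)
  case (relation t u)
  then show ?case
    by (rule assms(2))
next
  case (sym t u)
  then show ?case by simp
next
  case (trans t u w)
  then show ?case by simp
qed (intro ext, simp add: eval_add eval_scale algebra_simps; fail)+

section \<open>The action on infinite paths\<close>

locale self_similar_action = graph_action G E av ae
  for G :: "('g, 'm) monoid_scheme" (structure) and E :: "('v, 'e) pre_digraph"
    and av :: "'g \<Rightarrow> 'v \<Rightarrow> 'v" and ae :: "'g \<Rightarrow> 'e \<Rightarrow> 'e" +
  fixes \<phi> :: "'g \<Rightarrow> 'e \<Rightarrow> 'g"
  assumes cocycle: "one_cocycle G (arcs E) ae \<phi>"
    and cocycle_vertex: "\<And>g e v. \<lbrakk>g \<in> carrier G; e \<in> arcs E; v \<in> verts E\<rbrakk> \<Longrightarrow> av (\<phi> g e) v = av g v"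
begin

lemma cocycle_closed [simp]: "\<lbrakk>g \<in> carrier G; e \<in> arcs E\<rbrakk> \<Longrightarrow> \<phi> g e \<in> carrier G"
  using cocycle by (auto simp: one_cocycle_def)

lemma cocycle_mult:
  "\<lbrakk>g \<in> carrier G; h \<in> carrier G; e \<in> arcs E\<rbrakk> \<Longrightarrow> \<phi> (g \<otimes> h) e = \<phi> g (ae h e) \<otimes> \<phi> h e"
  using cocycle by (auto simp: one_cocycle_def)

lemma edge_closed [simp]: "\<lbrakk>g \<in> carrier G; e \<in> arcs E\<rbrakk> \<Longrightarrow> ae g e \<in> arcs E"
  using edge_action.element_image by blast

lemma vertex_closed [simp]: "\<lbrakk>g \<in> carrier G; v \<in> verts E\<rbrakk> \<Longrightarrow> av g v \<in> verts E"
  using vertex_action.element_image by blast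

lemma edge_mult: "\<lbrakk>g \<in> carrier G; h \<in> carrier G; e \<in> arcs E\<rbrakk> \<Longrightarrow> ae (g \<otimes> h) e = ae g (ae h e)"
  using edge_action.composition_rule by blast

lemma vertex_mult: "\<lbrakk>g \<in> carrier G; h \<in> carrier G; v \<in> verts E\<rbrakk> \<Longrightarrow> av (g \<otimes> h) v = av g (av h v)"
  using vertex_action.composition_rule by blast

lemma edge_one [simp]: "e \<in> arcs E \<Longrightarrow> ae \<one> e = e"
  using edge_action.id_eq_one by (metis restrict_apply)

lemma vertex_one [simp]: "v \<in> verts E \<Longrightarrow> av \<one> v = v"
  using vertex_action.id_eq_one by (metis restrict_apply)

lemma vertex_inverse [simp]:
  assumes "g \<in> carrier G" "v \<in> verts E"
  shows "av g (av (inv g) v) = v" "av (inv g) (av g v) = v"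
  using assms vertex_mult[of g "inv g" v] vertex_mult[of "inv g" g v] by simp_all

lemma edge_inverse [simp]:
  assumes "g \<in> carrier G" "e \<in> arcs E"
  shows "ae g (ae (inv g) e) = e" "ae (inv g) (ae g e) = e"
  using assms edge_mult[of g "inv g" e] edge_mult[of "inv g" g e] by simp_all

lemma vertex_eq_iff [simp]:
  assumes "g \<in> carrier G" "v \<in> verts E" "w \<in> verts E"
  shows "av g v = av g w \<longleftrightarrow> v = w"
  using assms vertex_inverse(2) by metis

lemma vertex_inv_iff:
  assumes "g \<in> carrier G" "v \<in> verts E" "w \<in> verts E"
  shows "av (inv g) v = w \<longleftrightarrow> v = av g w"
  using assms by auto

lemma edge_inv_iff:
  assumes "g \<in> carrier G" "e \<in> arcs E" "f \<in> arcs E"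
  shows "ae (inv g) e = f \<longleftrightarrow> e = ae g f"
  using assms by auto

lemma cocycle_one [simp]:
  assumes "e \<in> arcs E"
  shows "\<phi> \<one> e = \<one>"
  using cocycle_mult[of \<one> \<one> e] assms cocycle_closed[of \<one> e] by (simp add: r_cancel_one')

text \<open>The inverse of \<open>y \<mapsto> g \<cdot> (e y)\<close> removes the edge \<open>g \<cdot> e\<close> and then acts by the inverse of \<open>\<phi>(g,e)\<close>; this
  is what makes the relation for \<open>P\<^bsub>v,f\<^esub> S\<^bsub>e,g\<^esub>\<close> hold on infinite paths.\<close>

lemma cocycle_inv:
  assumes "g \<in> carrier G" "e \<in> arcs E"
  shows "\<phi> (inv g) (ae g e) = inv (\<phi> g e)"
  using assms cocycle_mult[of "inv g" g e] by (simp add: inv_equality)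

definition infinite_paths :: "(nat \<Rightarrow> 'e) set" where
  "infinite_paths = {x. \<forall>i. x i \<in> arcs E \<and> tail E (x i) = head E (x (Suc i))}"

definition path_range :: "(nat \<Rightarrow> 'e) \<Rightarrow> 'v" where
  "path_range x = head E (x 0)"

abbreviation shift :: "(nat \<Rightarrow> 'e) \<Rightarrow> nat \<Rightarrow> 'e" where
  "shift x \<equiv> \<lambda>i. x (Suc i)"

abbreviation prepend :: "'e \<Rightarrow> (nat \<Rightarrow> 'e) \<Rightarrow> nat \<Rightarrow> 'e" where
  "prepend e x \<equiv> case_nat e x"

primrec cocycle_at :: "'g \<Rightarrow> (nat \<Rightarrow> 'e) \<Rightarrow> nat \<Rightarrow> 'g" where
  "cocycle_at g x 0 = g"
| "cocycle_at g x (Suc n) = \<phi> (cocycle_at g x n) (x n)"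

text \<open>The action on infinite paths extends the recursion \<open>g \<cdot> (e \<alpha>) = (g \<cdot> e) (\<phi>(g,e) \<cdot> \<alpha>)\<close>: the edge with
  index \<open>n\<close> is moved by \<open>\<phi>(g, x\<^sub>0 \<dots> x\<^bsub>n-1\<^esub>)\<close>, which is \<open>cocycle_at g x n\<close>.\<close>

definition act :: "'g \<Rightarrow> (nat \<Rightarrow> 'e) \<Rightarrow> nat \<Rightarrow> 'e" where
  "act g x n = ae (cocycle_at g x n) (x n)"

lemma infinite_pathsI:
  "\<lbrakk>\<And>i. x i \<in> arcs E; \<And>i. tail E (x i) = head E (x (Suc i))\<rbrakk> \<Longrightarrow> x \<in> infinite_paths"
  by (simp add: infinite_paths_def)

lemma infinite_path_step: "x \<in> infinite_paths \<Longrightarrow> tail E (x i) = head E (x (Suc i))"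
  by (simp add: infinite_paths_def)

lemma infinite_path_edge [simp]: "x \<in> infinite_paths \<Longrightarrow> x i \<in> arcs E"
  by (simp add: infinite_paths_def)

lemma path_range_closed [simp]: "x \<in> infinite_paths \<Longrightarrow> path_range x \<in> verts E"
  by (simp add: path_range_def)

lemma shift_closed [simp]: "x \<in> infinite_paths \<Longrightarrow> shift x \<in> infinite_paths"
  by (intro infinite_pathsI) (simp_all add: infinite_path_step)

lemma path_range_shift [simp]: "x \<in> infinite_paths \<Longrightarrow> path_range (shift x) = tail E (x 0)"
  by (simp add: infinite_path_step path_range_def)

lemma path_range_prepend [simp]: "path_range (prepend e x) = head E e"
  by (simp add: path_range_def)

lemma prepend_closed [simp]:
  "\<lbrakk>x \<in> infinite_paths; e \<in> arcs E; tail E e = path_range x\<rbrakk> \<Longrightarrow> prepend e x \<in> infinite_paths"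
  by (intro infinite_pathsI) (auto simp: infinite_path_step path_range_def split: nat.splits)

lemma prepend_shift: "x 0 = e \<Longrightarrow> prepend e (shift x) = x"
  by (auto simp: fun_eq_iff split: nat.splits)

lemma cocycle_at_closed [simp]:
  "\<lbrakk>g \<in> carrier G; x \<in> infinite_paths\<rbrakk> \<Longrightarrow> cocycle_at g x n \<in> carrier G"
  by (induction n) auto

lemma act_closed [simp]:
  assumes "g \<in> carrier G" "x \<in> infinite_paths"
  shows "act g x \<in> infinite_paths"
  using assms
  by (intro infinite_pathsI)
    (simp_all add: act_def head_equivariant tail_equivariant cocycle_vertex infinite_path_step)

lemma path_range_act [simp]:
  "\<lbrakk>g \<in> carrier G; x \<in> infinite_paths\<rbrakk> \<Longrightarrow> path_range (act g x) = av g (path_range x)"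
  by (simp add: path_range_def act_def head_equivariant)

lemma cocycle_at_mult:
  "\<lbrakk>g \<in> carrier G; h \<in> carrier G; x \<in> infinite_paths\<rbrakk> \<Longrightarrow>
    cocycle_at (g \<otimes> h) x n = cocycle_at g (act h x) n \<otimes> cocycle_at h x n"
  by (induction n) (auto simp: cocycle_mult act_def)

lemma act_mult:
  "\<lbrakk>g \<in> carrier G; h \<in> carrier G; x \<in> infinite_paths\<rbrakk> \<Longrightarrow> act (g \<otimes> h) x = act g (act h x)"
  by (rule ext) (simp add: act_def cocycle_at_mult edge_mult[symmetric])

lemma cocycle_at_one: "x \<in> infinite_paths \<Longrightarrow> cocycle_at \<one> x n = \<one>"
  by (induction n) auto

lemma act_one [simp]: "x \<in> infinite_paths \<Longrightarrow> act \<one> x = x"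
  by (rule ext) (simp add: act_def cocycle_at_one)

lemma act_0: "act g x 0 = ae g (x 0)"
  by (simp add: act_def)

lemma cocycle_at_shift: "cocycle_at (\<phi> g (x 0)) (shift x) n = cocycle_at g x (Suc n)"
  by (induction n) auto

lemma shift_act: "shift (act g x) = act (\<phi> g (x 0)) (shift x)"
  by (rule ext) (simp only: act_def cocycle_at_shift)

lemma act_prepend: "act g (prepend e x) = prepend (ae g e) (act (\<phi> g e) x)"
  using prepend_shift[of "act g (prepend e x)" "ae g e"] shift_act[of g "prepend e x"]
  by (simp add: act_0)

text \<open>Without sources a path can be prolonged forever at its source end.\<close>

lemma infinite_path_exists:
  assumes "no_sources E" "v \<in> verts E"
  shows "\<exists>x\<in>infinite_paths. path_range x = v"
proof -
  have "\<exists>e. \<forall>w\<in>verts E. e w \<in> arcs E \<and> head E (e w) = w"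
    using assms(1) by (intro bchoice) (auto simp: no_sources_def in_arcs_def)
  then obtain e where e: "\<And>w. w \<in> verts E \<Longrightarrow> e w \<in> arcs E \<and> head E (e w) = w"
    by blast
  define vs where "vs = rec_nat v (\<lambda>_ w. tail E (e w))"
  have vs: "vs 0 = v" "\<And>i. vs (Suc i) = tail E (e (vs i))"
    by (simp_all add: vs_def)
  have vs_closed: "vs i \<in> verts E" for i
    using assms(2) by (induction i) (auto simp: vs e)
  then have "(\<lambda>i. e (vs i)) \<in> infinite_paths"
    by (intro infinite_pathsI) (simp_all add: vs e)
  then show ?thesis
    by (intro bexI[of _ "\<lambda>i. e (vs i)"]) (simp add: path_range_def e vs_closed vs(1) assms(2))
qed

definition cylinder :: "(nat \<Rightarrow> 'e) \<Rightarrow> nat \<Rightarrow> (nat \<Rightarrow> 'e) set" where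
  "cylinder x n = {y \<in> infinite_paths. \<forall>i<n. y i = x i}"

lemma cylinder_self: "x \<in> infinite_paths \<Longrightarrow> x \<in> cylinder x n"
  by (simp add: cylinder_def)

lemma cylinder_mono: "m \<le> n \<Longrightarrow> y \<in> cylinder x m \<Longrightarrow> cylinder y n \<subseteq> cylinder x m"
  by (auto simp: cylinder_def)

text \<open>Equal prefixes produce equal cocycle values, so the action does not lose any precision.\<close>

lemma act_cylinder:
  assumes "g \<in> carrier G" "x \<in> infinite_paths" "y \<in> cylinder x n"
  shows "act g y \<in> cylinder (act g x) n"
proof -
  have "i \<le> n \<Longrightarrow> cocycle_at g y i = cocycle_at g x i" for i
    using assms(3) by (induction i) (auto simp: cylinder_def)
  then show ?thesis
    using assms by (auto simp: cylinder_def act_def)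
qed

section \<open>The representation on functions of infinite paths\<close>

text \<open>An operator that moves point masses along a partial bijection \<open>\<tau>\<close> sends a function \<open>f\<close> to the pullback
  of \<open>f\<close> along the inverse of \<open>\<tau>\<close>. Thus \<open>True\<close> selects the inverse of the map \<open>y \<mapsto> g \<cdot> y\<close> or
  \<open>y \<mapsto> e (g \<cdot> y)\<close> that defines the generator, and \<open>False\<close>, for the star, the map itself.\<close>

fun generator_map ::
    "bool \<Rightarrow> ('v, 'e, 'g) ep_generator \<Rightarrow> (nat \<Rightarrow> 'e) \<Rightarrow> (nat \<Rightarrow> 'e) option" where
  "generator_map True (GenP v g) x =
    (if x \<in> infinite_paths \<and> path_range x = v then Some (act (inv g) x) else None)"
| "generator_map False (GenP v g) x =
    (if x \<in> infinite_paths \<and> path_range (act g x) = v then Some (act g x) else None)"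
| "generator_map True (GenS e g) x =
    (if x \<in> infinite_paths \<and> x 0 = e then Some (act (inv g) (shift x)) else None)"
| "generator_map False (GenS e g) x =
    (if x \<in> infinite_paths \<and> path_range (act g x) = tail E e
     then Some (prepend e (act g x)) else None)"

abbreviation operator ::
    "bool \<Rightarrow> ('k::field, 'v, 'e, 'g) ep_term \<Rightarrow> ((nat \<Rightarrow> 'e) \<Rightarrow> 'k) \<Rightarrow> (nat \<Rightarrow> 'e) \<Rightarrow> 'k" where
  "operator \<equiv> eval generator_map"

abbreviation "ep_congruence \<equiv> star_congruence (ep_generators G E) (ep_relations G E av ae \<phi>)"

lemma GenP_in_ep_generators [simp]:
  "GenP v f \<in> ep_generators G E \<longleftrightarrow> v \<in> verts E \<and> f \<in> carrier G"
  by (auto simp: ep_generators_def)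

lemma GenS_in_ep_generators [simp]:
  "GenS e g \<in> ep_generators G E \<longleftrightarrow> e \<in> arcs E \<and> g \<in> carrier G"
  by (auto simp: ep_generators_def)

lemma operator_edge_projection:
  assumes "e \<in> arcs E"
  shows "operator b (Mult (S_term e \<one>) (Star (S_term e \<one>))) f =
    (\<lambda>x. if x \<in> infinite_paths \<and> x 0 = e then f x else 0)"
  using assms by (cases b) (auto simp: fun_eq_iff pullback_def prepend_shift)

lemma operator_edge_projections:
  assumes "set es \<subseteq> arcs E" "distinct es"
  shows "operator b (foldr (\<lambda>e t. Add (Mult (S_term e \<one>) (Star (S_term e \<one>))) t) es Zero) f =
    (\<lambda>x. if x \<in> infinite_paths \<and> x 0 \<in> set es then f x else 0)"
  using assms
proof (induction es)
  case (Cons e es)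
  then show ?case
    using operator_edge_projection[of e b f]
    by (auto simp: fun_eq_iff simp del: eval.simps(5))
qed auto

lemma operator_vertex_projection:
  assumes "v \<in> verts E"
  shows "operator b (P_term v \<one>) f =
    (\<lambda>x. if x \<in> infinite_paths \<and> path_range x = v then f x else 0)"
  using assms by (cases b) (auto simp: fun_eq_iff pullback_def)

text \<open>Each relation is an identity between partial maps and is checked point by point, both for the
  operators and for their transposes. The sum relation says that every infinite path with range \<open>v\<close>
  starts with exactly one of the edges in \<open>in_arcs E v\<close>.\<close>

lemma operator_respects_relations:
  assumes "(t, u) \<in> ep_relations G E av ae \<phi>"
  shows "operator b t = operator b u"
  using assms
proof cases
  case (sum_v v es)
  then have "set es \<subseteq> arcs E"
    by auto
  with sum_v have "operator b u f =
      (\<lambda>x. if x \<in> infinite_paths \<and> x 0 \<in> set es then f x else 0)" for f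
    using operator_edge_projections by blast
  with sum_v show ?thesis
    by (auto simp: fun_eq_iff operator_vertex_projection path_range_def simp del: eval.simps(1))
next
  case (P_star v f)
  then show ?thesis
    by (cases b) (auto simp: fun_eq_iff pullback_def vertex_inv_iff)
next
  case (PP v w f h)
  then show ?thesis
    by (cases b) (auto simp: fun_eq_iff pullback_def vertex_inv_iff act_mult vertex_mult inv_mult_group)
next
  case (PS v e f g)
  have "shift (act (inv f) x) = act (inv (\<phi> f e)) (shift x)" if "x 0 = ae f e" for x
    using PS that cocycle_inv[of f e] by (simp add: shift_act)
  moreover have "path_range x = av f (head E e)" if "x 0 = ae f e" for x
    using PS that by (simp add: path_range_def head_equivariant)
  ultimately show ?thesis
    using PS
    by (cases b) (auto simp: fun_eq_iff pullback_def vertex_inv_iff edge_inv_iff act_mult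
        act_prepend act_0 vertex_mult inv_mult_group tail_equivariant head_equivariant cocycle_vertex)
next
  case (SP v e f g)
  show ?thesis
  proof (cases "av g v = tail E e")
    case True
    then have "tail E e = av g v" ..
    with SP show ?thesis
      by (cases b) (auto simp: fun_eq_iff pullback_def vertex_inv_iff act_mult
          vertex_mult inv_mult_group)
  next
    case False
    with SP show ?thesis
      by (cases b) (auto simp: fun_eq_iff pullback_def vertex_inv_iff act_mult
          vertex_mult inv_mult_group)
  qed
next
  case (ps e)
  then show ?thesis
    by (cases b) (auto simp: fun_eq_iff pullback_def path_range_def)
next
  case (pp v w)
  then show ?thesis
    by (cases b) (auto simp: fun_eq_iff pullback_def)
next
  case (sp e)
  then show ?thesis
    by (cases b) (auto simp: fun_eq_iff pullback_def)
next
  case (s_star_p e)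
  then show ?thesis
    by (cases b) (auto simp: fun_eq_iff pullback_def path_range_def)
next
  case (ps_star e)
  then show ?thesis
    by (cases b) (auto simp: fun_eq_iff pullback_def)
next
  case (s_star_s e f)
  show ?thesis
  proof (cases "e = f")
    case True
    with s_star_s show ?thesis
      by (cases b) (auto simp: fun_eq_iff pullback_def)
  next
    case False
    with s_star_s show ?thesis
      by (cases b) (auto simp: fun_eq_iff pullback_def)
  qed
qed

lemma operator_respects_ep_congruence:
  assumes "(t, u) \<in> ep_congruence"
  shows "operator b t = operator b u"
  using assms by (rule eval_respects_star_congruence) (rule operator_respects_relations)

section \<open>Locality of the operators\<close>

text \<open>Continuity of a partial map on the space of infinite paths, together with the requirement that its domain
  be open and closed. The cylinders \<open>cylinder x n\<close> are the basic neighbourhoods of \<open>x\<close>.\<close>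

definition partial_continuous :: "((nat \<Rightarrow> 'e) \<Rightarrow> (nat \<Rightarrow> 'e) option) \<Rightarrow> bool" where
  "partial_continuous \<theta> \<longleftrightarrow> (\<forall>x. case \<theta> x of
       None \<Rightarrow> x \<in> infinite_paths \<longrightarrow> (\<exists>m. \<forall>x'\<in>cylinder x m. \<theta> x' = None)
     | Some y \<Rightarrow> x \<in> infinite_paths \<and> y \<in> infinite_paths \<and>
         (\<forall>n. \<exists>m. \<forall>x'\<in>cylinder x m. \<exists>y'\<in>cylinder y n. \<theta> x' = Some y'))"

lemma partial_continuous_NoneD:
  assumes "partial_continuous \<theta>" "\<theta> x = None" "x \<in> infinite_paths"
  shows "\<exists>m. \<forall>x'\<in>cylinder x m. \<theta> x' = None"
  using assms unfolding partial_continuous_def by (auto dest!: spec[of _ x])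

lemma partial_continuous_SomeD:
  assumes "partial_continuous \<theta>" "\<theta> x = Some y"
  shows "x \<in> infinite_paths" "y \<in> infinite_paths"
    "\<exists>m. \<forall>x'\<in>cylinder x m. \<exists>y'\<in>cylinder y n. \<theta> x' = Some y'"
  using assms unfolding partial_continuous_def by (auto dest!: spec[of _ x])

lemma partial_continuous_compose:
  assumes "partial_continuous \<theta>" "partial_continuous \<eta>"
  shows "partial_continuous (\<lambda>x. Option.bind (\<theta> x) \<eta>)"
  unfolding partial_continuous_def
proof
  fix x
  show "case Option.bind (\<theta> x) \<eta> of
       None \<Rightarrow> x \<in> infinite_paths \<longrightarrow> (\<exists>m. \<forall>x'\<in>cylinder x m. Option.bind (\<theta> x') \<eta> = None)
     | Some z \<Rightarrow> x \<in> infinite_paths \<and> z \<in> infinite_paths \<and>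
         (\<forall>n. \<exists>m. \<forall>x'\<in>cylinder x m. \<exists>z'\<in>cylinder z n. Option.bind (\<theta> x') \<eta> = Some z')"
  proof (cases "\<theta> x")
    case None
    then show ?thesis
      using partial_continuous_NoneD[OF assms(1) None] by fastforce
  next
    case (Some y)
    note y = partial_continuous_SomeD[OF assms(1) Some]
    show ?thesis
    proof (cases "\<eta> y")
      case None
      obtain n where n: "\<And>y'. y' \<in> cylinder y n \<Longrightarrow> \<eta> y' = None"
        using partial_continuous_NoneD[OF assms(2) None y(2)] by blast
      have "\<exists>m. \<forall>x'\<in>cylinder x m. Option.bind (\<theta> x') \<eta> = None"
        using y(3)[of n] n by fastforce
      with Some None show ?thesis by simp
    next
      case (Some z)
      note z = partial_continuous_SomeD[OF assms(2) Some]
      have "\<exists>m. \<forall>x'\<in>cylinder x m. \<exists>z'\<in>cylinder z k. Option.bind (\<theta> x') \<eta> = Some z'" for k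
      proof -
        obtain n where n: "\<forall>y'\<in>cylinder y n. \<exists>z'\<in>cylinder z k. \<eta> y' = Some z'"
          using z(3) by blast
        obtain m where "\<forall>x'\<in>cylinder x m. \<exists>y'\<in>cylinder y n. \<theta> x' = Some y'"
          using y(3) by blast
        with n show ?thesis
          by (metis bind.bind_lunit)
      qed
      with \<open>\<theta> x = Some y\<close> Some y z show ?thesis by simp
    qed
  qed
qed

lemma shift_cylinder: "y \<in> cylinder x (Suc n) \<Longrightarrow> shift y \<in> cylinder (shift x) n"
  by (auto simp: cylinder_def)

lemma prepend_cylinder:
  assumes "y \<in> cylinder x n" "e \<in> arcs E" "path_range y = tail E e"
  shows "prepend e y \<in> cylinder (prepend e x) n"
  using assms by (auto simp: cylinder_def split: nat.splits)

lemma cylinder_Suc_0: "y \<in> cylinder x (Suc n) \<Longrightarrow> y 0 = x 0"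
  by (simp add: cylinder_def)

lemma path_range_cylinder: "y \<in> cylinder x (Suc n) \<Longrightarrow> path_range y = path_range x"
  by (simp add: path_range_def cylinder_Suc_0)

lemma cylinder_infinite_path: "y \<in> cylinder x n \<Longrightarrow> y \<in> infinite_paths"
  by (simp add: cylinder_def)

lemma cylinder_SucD: "y \<in> cylinder x (Suc n) \<Longrightarrow> y \<in> cylinder x n"
  by (simp add: cylinder_def)

text \<open>The generators satisfy a uniform version: \<open>n + 1\<close> edges of the argument determine \<open>n\<close> edges of the
  value, the loss of one edge being due to the shift.\<close>

lemma partial_continuousI:
  assumes "\<And>x x'. \<lbrakk>x \<in> infinite_paths; x' \<in> cylinder x 1; \<theta> x = None\<rbrakk> \<Longrightarrow> \<theta> x' = None"
    and "\<And>x y. \<theta> x = Some y \<Longrightarrow> x \<in> infinite_paths \<and> y \<in> infinite_paths"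
    and "\<And>x y x' n. \<lbrakk>\<theta> x = Some y; x' \<in> cylinder x (Suc n)\<rbrakk> \<Longrightarrow>
      \<exists>y'\<in>cylinder y n. \<theta> x' = Some y'"
  shows "partial_continuous \<theta>"
  unfolding partial_continuous_def
proof
  fix x
  show "case \<theta> x of
       None \<Rightarrow> x \<in> infinite_paths \<longrightarrow> (\<exists>m. \<forall>x'\<in>cylinder x m. \<theta> x' = None)
     | Some y \<Rightarrow> x \<in> infinite_paths \<and> y \<in> infinite_paths \<and>
         (\<forall>n. \<exists>m. \<forall>x'\<in>cylinder x m. \<exists>y'\<in>cylinder y n. \<theta> x' = Some y')"
  proof (cases "\<theta> x")
    case None
    then show ?thesis
      using assms(1)[of x] by (auto intro!: exI[of _ 1])
  next
    case (Some y)
    then have "\<exists>m. \<forall>x'\<in>cylinder x m. \<exists>y'\<in>cylinder y n. \<theta> x' = Some y'" for n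
      using assms(3)[OF Some] by blast
    with Some assms(2)[OF Some] show ?thesis
      by simp
  qed
qed

lemma partial_continuous_generator_map:
  assumes "\<gamma> \<in> ep_generators G E"
  shows "partial_continuous (generator_map b \<gamma>)"
proof (cases \<gamma>)
  case (GenP v g)
  with assms have "v \<in> verts E" "g \<in> carrier G" by simp_all
  with GenP show ?thesis
    by (cases b; intro partial_continuousI)
      (auto split: if_splits
        dest: path_range_cylinder cylinder_infinite_path cylinder_SucD intro: act_cylinder)
next
  case (GenS e g)
  with assms have "e \<in> arcs E" "g \<in> carrier G" by simp_all
  with GenS show ?thesis
    by (cases b; intro partial_continuousI)
      (auto split: if_splits
        dest: cylinder_Suc_0 path_range_cylinder cylinder_infinite_path cylinder_SucD
        intro: act_cylinder shift_cylinder prepend_cylinder)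
qed

text \<open>All operators of the algebra are of this kind. Unlike the terms, the class has no product among its
  constructors, so the diagonal part of an operator can be studied by induction.\<close>

inductive local_operator :: "(((nat \<Rightarrow> 'e) \<Rightarrow> 'k::field) \<Rightarrow> (nat \<Rightarrow> 'e) \<Rightarrow> 'k) \<Rightarrow> bool" where
  pullback: "partial_continuous \<theta> \<Longrightarrow> local_operator (pullback \<theta>)"
| zero: "local_operator (\<lambda>f x. 0)"
| add: "\<lbrakk>local_operator A; local_operator B\<rbrakk> \<Longrightarrow> local_operator (\<lambda>f x. A f x + B f x)"
| scale: "local_operator A \<Longrightarrow> local_operator (\<lambda>f x. a * A f x)"

lemma local_operator_compose:
  fixes A B :: "((nat \<Rightarrow> 'e) \<Rightarrow> 'k::field) \<Rightarrow> (nat \<Rightarrow> 'e) \<Rightarrow> 'k"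
  assumes "local_operator A" "local_operator B"
  shows "local_operator (\<lambda>f. A (B f))"
  using assms(1)
proof induction
  case (pullback \<theta>)
  show ?case
    using assms(2)
  proof induction
    case (pullback \<eta>)
    have "(\<lambda>f :: (nat \<Rightarrow> 'e) \<Rightarrow> 'k. pullback \<theta> (pullback \<eta> f)) =
        pullback (\<lambda>x. Option.bind (\<theta> x) \<eta>)"
      by (auto simp: fun_eq_iff pullback_def split: option.splits Option.bind_split)
    then show ?case
      using partial_continuous_compose[OF \<open>partial_continuous \<theta>\<close> pullback]
      by (simp add: local_operator.pullback)
  next
    case zero
    have "(\<lambda>f :: (nat \<Rightarrow> 'e) \<Rightarrow> 'k. pullback \<theta> (\<lambda>x. 0 :: 'k)) = (\<lambda>f x. 0)"
      by (auto simp: fun_eq_iff pullback_def split: option.splits)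
    then show ?case
      by (simp add: local_operator.zero)
  next
    case (add A B)
    have "(\<lambda>f :: (nat \<Rightarrow> 'e) \<Rightarrow> 'k. pullback \<theta> (\<lambda>x. A f x + B f x)) =
        (\<lambda>f x. pullback \<theta> (A f) x + pullback \<theta> (B f) x)"
      by (auto simp: fun_eq_iff pullback_def split: option.splits)
    with add show ?case
      by (simp add: local_operator.add)
  next
    case (scale A a)
    have "(\<lambda>f :: (nat \<Rightarrow> 'e) \<Rightarrow> 'k. pullback \<theta> (\<lambda>x. a * A f x)) = (\<lambda>f x. a * pullback \<theta> (A f) x)"
      by (auto simp: fun_eq_iff pullback_def split: option.splits)
    with scale show ?case
      by (simp add: local_operator.scale)
  qed
qed (simp_all add: local_operator.intros)

lemma local_operator_term:
  assumes "t \<in> star_terms (ep_generators G E)"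
  shows "local_operator (operator b t)"
  using assms
proof (induction t arbitrary: b)
  case (Gen \<gamma>)
  have "operator b (Gen \<gamma>) = pullback (generator_map b \<gamma>)"
    by (simp add: fun_eq_iff)
  with Gen show ?case
    by (simp add: local_operator.pullback partial_continuous_generator_map)
next
  case Zero
  have "operator b Zero = (\<lambda>f x. 0)"
    by (simp add: fun_eq_iff)
  then show ?case
    by (simp add: local_operator.zero)
next
  case (Add t u)
  have "operator b (Add t u) = (\<lambda>f x. operator b t f x + operator b u f x)"
    by (simp add: fun_eq_iff)
  with Add show ?case
    by (simp add: local_operator.add)
next
  case (Smult a t)
  have "operator b (Smult a t) = (\<lambda>f x. a * operator b t f x)"
    by (simp add: fun_eq_iff)
  with Smult show ?case
    by (simp add: local_operator.scale)
next
  case (Mult t u)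
  have "operator b (Mult t u) =
      (if b then (\<lambda>f. operator b t (operator b u f)) else (\<lambda>f. operator b u (operator b t f)))"
    by (simp add: fun_eq_iff)
  with Mult show ?case
    by (simp add: local_operator_compose)
next
  case (Star t)
  have "operator b (Star t) = operator (\<not> b) t"
    by (simp add: fun_eq_iff)
  with Star show ?case
    by simp
qed

text \<open>Consider \<open>pullback \<theta>\<close> on a cylinder. Either \<open>\<theta>\<close> fixes all of its points, and \<open>c = 1\<close>, or some point \<open>y\<close> is
  not fixed; then a neighbourhood of \<open>y\<close> is disjoint from its image, and \<open>c = 0\<close>. The
  property passes to smaller cylinders, so for a sum one refines first for one summand and then for
  the other.\<close>

lemma local_operator_scalar_on_cylinder:
  fixes A :: "((nat \<Rightarrow> 'e) \<Rightarrow> 'k::field) \<Rightarrow> (nat \<Rightarrow> 'e) \<Rightarrow> 'k"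
  assumes "local_operator A" "x \<in> infinite_paths"
  shows "\<exists>y\<in>cylinder x n. \<exists>m\<ge>n. \<exists>c. \<forall>f. (\<forall>z. z \<notin> cylinder y m \<longrightarrow> f z = 0) \<longrightarrow>
    (\<forall>z\<in>cylinder y m. A f z = c * f z)"
  using assms
proof (induction arbitrary: x n)
  case (pullback \<theta>)
  show ?case
  proof (cases "\<forall>y\<in>cylinder x n. \<theta> y = Some y")
    case True
    then have "\<forall>z\<in>cylinder x n. pullback \<theta> f z = 1 * f z" for f :: "(nat \<Rightarrow> 'e) \<Rightarrow> 'k"
      by (simp add: pullback_def)
    then show ?thesis
      using cylinder_self[OF pullback(2)] by blast
  next
    case False
    then obtain y where y: "y \<in> cylinder x n" "\<theta> y \<noteq> Some y"
      by blast
    then have y_path: "y \<in> infinite_paths"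
      by (simp add: cylinder_infinite_path)
    \<comment> \<open>A neighbourhood of \<open>y\<close> that \<open>\<theta>\<close> moves off itself.\<close>
    have "\<exists>m. \<forall>z\<in>cylinder y m. \<forall>w\<in>cylinder y m. \<theta> z \<noteq> Some w"
    proof (cases "\<theta> y")
      case None
      then show ?thesis
        using partial_continuous_NoneD[OF pullback(1) None y_path] by (metis option.distinct(1))
    next
      case (Some w)
      with y(2) obtain i where i: "w i \<noteq> y i"
        by auto
      obtain m where m: "\<forall>z\<in>cylinder y m. \<exists>w'\<in>cylinder w (Suc i). \<theta> z = Some w'"
        using partial_continuous_SomeD(3)[OF pullback(1) Some] by blast
      have "\<theta> z \<noteq> Some w'" if zw: "z \<in> cylinder y (max m (Suc i))" "w' \<in> cylinder y (max m (Suc i))" for z w'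
      proof -
        have "z \<in> cylinder y m" "w' i = y i"
          using zw by (auto simp: cylinder_def)
        with m i show ?thesis
          by (auto simp: cylinder_def)
      qed
      then show ?thesis
        by blast
    qed
    then obtain m where m: "\<And>z w. \<lbrakk>z \<in> cylinder y m; w \<in> cylinder y m\<rbrakk> \<Longrightarrow> \<theta> z \<noteq> Some w"
      by blast
    have "pullback \<theta> f z = 0 * f z"
      if f: "\<forall>z. z \<notin> cylinder y (max m n) \<longrightarrow> f z = 0" and z: "z \<in> cylinder y (max m n)"
      for f :: "(nat \<Rightarrow> 'e) \<Rightarrow> 'k" and z
    proof (cases "\<theta> z")
      case (Some w)
      moreover have "cylinder y (max m n) \<subseteq> cylinder y m"
        by (auto simp: cylinder_def)
      ultimately have "w \<notin> cylinder y (max m n)"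
        using m[of z w] z by blast
      with Some f show ?thesis
        by (simp add: pullback_def)
    qed (simp add: pullback_def)
    then show ?thesis
      using y(1) by (intro bexI[of _ y] exI[of _ "max m n"] conjI exI[of _ 0]) auto
  qed
next
  case zero
  then show ?case
    using cylinder_self by (intro bexI[of _ x] exI[of _ n] conjI exI[of _ 0]) auto
next
  case (add A B)
  obtain y m c where y: "y \<in> cylinder x n" "m \<ge> n"
    "\<And>f z. \<lbrakk>\<forall>z. z \<notin> cylinder y m \<longrightarrow> f z = 0; z \<in> cylinder y m\<rbrakk> \<Longrightarrow> A f z = c * f z"
    using add.IH(1)[OF add.prems] by metis
  obtain w k d where w: "w \<in> cylinder y m" "k \<ge> m"
    "\<And>f z. \<lbrakk>\<forall>z. z \<notin> cylinder w k \<longrightarrow> f z = 0; z \<in> cylinder w k\<rbrakk> \<Longrightarrow> B f z = d * f z"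
    using add.IH(2)[OF cylinder_infinite_path[OF y(1)]] by metis
  have sub: "cylinder w k \<subseteq> cylinder y m"
    using cylinder_mono[OF w(2,1)] .
  have "A f z + B f z = (c + d) * f z"
    if "\<forall>z. z \<notin> cylinder w k \<longrightarrow> f z = 0" "z \<in> cylinder w k" for f z
    using y(3)[of f z] w(3)[of f z] that sub by (auto simp: algebra_simps)
  moreover have "w \<in> cylinder x n"
    using w(1) y(1,2) cylinder_mono by blast
  ultimately show ?case
    using w(2) y(2) by (intro bexI[of _ w] exI[of _ k] conjI exI[of _ "c + d"]) auto
next
  case (scale A a)
  obtain y m c where y: "y \<in> cylinder x n" "m \<ge> n"
    "\<And>f z. \<lbrakk>\<forall>z. z \<notin> cylinder y m \<longrightarrow> f z = 0; z \<in> cylinder y m\<rbrakk> \<Longrightarrow> A f z = c * f z"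
    using scale.IH[OF scale.prems] by metis
  then show ?case
    by (intro bexI[of _ y] exI[of _ m] conjI exI[of _ "a * c"]) auto
qed

lemma operator_outside:
  fixes t :: "('k::field, 'v, 'e, 'g) ep_term"
  assumes "t \<in> star_terms (ep_generators G E)" "x \<notin> infinite_paths"
  shows "operator b t f x = 0"
proof -
  have "A f x = 0" if "local_operator A" for A :: "((nat \<Rightarrow> 'e) \<Rightarrow> 'k) \<Rightarrow> (nat \<Rightarrow> 'e) \<Rightarrow> 'k"
    using that
  proof induction
    case (pullback \<theta>)
    then have "\<theta> x = None"
      using assms(2) partial_continuous_SomeD(1) by (cases "\<theta> x") auto
    then show ?case
      by (simp add: pullback_def)
  qed simp_all
  then show ?thesis
    using local_operator_term[OF assms(1)] by blast
qed

text \<open>If \<open>A\<close> is linear, then \<open>source_in F A\<close> says that \<open>A\<close> vanishes on functions supported on infinite paths with range outside \<open>F\<close>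
  and does not see the values of its argument away from the infinite paths.\<close>

definition source_in :: "'v set \<Rightarrow> (((nat \<Rightarrow> 'e) \<Rightarrow> 'k) \<Rightarrow> (nat \<Rightarrow> 'e) \<Rightarrow> 'k) \<Rightarrow> bool" where
  "source_in F A \<longleftrightarrow>
    (\<forall>f g. (\<forall>x\<in>infinite_paths. path_range x \<in> F \<longrightarrow> f x = g x) \<longrightarrow> A f = A g)"

lemma source_inD:
  assumes "source_in F A" "\<And>x. \<lbrakk>x \<in> infinite_paths; path_range x \<in> F\<rbrakk> \<Longrightarrow> f x = g x"
  shows "A f = A g"
  using assms unfolding source_in_def by blast

text \<open>Every generator and every star of a generator has a single source vertex. In a product only the factor
  that acts first matters.\<close>

lemma operator_finite_source:
  fixes t :: "('k::field, 'v, 'e, 'g) ep_term"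
  assumes "t \<in> star_terms (ep_generators G E)"
  shows "\<exists>F. finite F \<and> F \<subseteq> verts E \<and> source_in F (operator b t)"
  using assms
proof (induction t arbitrary: b)
  case (Gen \<gamma>)
  have "\<exists>u\<in>verts E. \<forall>x y. generator_map b \<gamma> x = Some y \<longrightarrow> y \<in> infinite_paths \<and> path_range y = u"
  proof (cases \<gamma>)
    case (GenP v g)
    with Gen show ?thesis
      by (intro bexI[of _ "if b then av (inv g) v else v"]) (auto split: if_splits)
  next
    case (GenS e g)
    with Gen show ?thesis
      by (intro bexI[of _ "if b then av (inv g) (tail E e) else head E e"])
        (auto split: if_splits)
  qed
  then obtain u where "u \<in> verts E"
    "\<And>x y. generator_map b \<gamma> x = Some y \<Longrightarrow> y \<in> infinite_paths \<and> path_range y = u"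
    by blast
  then show ?case
    by (intro exI[of _ "{u}"])
      (auto simp: source_in_def fun_eq_iff pullback_def split: option.split)
next
  case Zero
  then show ?case
    by (auto simp: source_in_def)
next
  case (Add t u)
  then obtain F F' where F: "finite F" "F \<subseteq> verts E" "source_in F (operator b t)"
    and F': "finite F'" "F' \<subseteq> verts E" "source_in F' (operator b u)"
    by (metis star_terms_simps(3))
  have "source_in (F \<union> F') (operator b (Add t u))"
    unfolding source_in_def
  proof (intro allI impI)
    fix f g :: "(nat \<Rightarrow> 'e) \<Rightarrow> 'k"
    assume "\<forall>x\<in>infinite_paths. path_range x \<in> F \<union> F' \<longrightarrow> f x = g x"
    then have "operator b t f = operator b t g" "operator b u f = operator b u g"
      by (auto intro: source_inD[OF F(3)] source_inD[OF F'(3)])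
    then show "operator b (Add t u) f = operator b (Add t u) g"
      by simp
  qed
  with F F' show ?case
    by (intro exI[of _ "F \<union> F'"]) blast
next
  case (Smult a t)
  then obtain F where F: "finite F" "F \<subseteq> verts E" "source_in F (operator b t)"
    by (metis star_terms_simps(4))
  have "source_in F (operator b (Smult a t))"
    unfolding source_in_def
  proof (intro allI impI)
    fix f g :: "(nat \<Rightarrow> 'e) \<Rightarrow> 'k"
    assume "\<forall>x\<in>infinite_paths. path_range x \<in> F \<longrightarrow> f x = g x"
    then have "operator b t f = operator b t g"
      by (intro source_inD[OF F(3)]) simp
    then show "operator b (Smult a t) f = operator b (Smult a t) g"
      by simp
  qed
  with F show ?case
    by blast
next
  case (Mult t u)
  then obtain F where F: "finite F" "F \<subseteq> verts E" "source_in F (operator b (if b then u else t))"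
    by (metis star_terms_simps(5))
  have "source_in F (operator b (Mult t u))"
    unfolding source_in_def
  proof (intro allI impI)
    fix f g :: "(nat \<Rightarrow> 'e) \<Rightarrow> 'k"
    assume "\<forall>x\<in>infinite_paths. path_range x \<in> F \<longrightarrow> f x = g x"
    then have "operator b (if b then u else t) f = operator b (if b then u else t) g"
      by (intro source_inD[OF F(3)]) simp
    then show "operator b (Mult t u) f = operator b (Mult t u) g"
      by (cases b) simp_all
  qed
  with F show ?case
    by blast
next
  case (Star t)
  have "operator b (Star t) = operator (\<not> b) t"
    by (simp add: fun_eq_iff)
  with Star show ?case
    by simp
qed

section \<open>Projections\<close>

text \<open>The projection \<open>s\<^sub>\<alpha> s\<^sub>\<alpha>\<^sup>*\<close> for the prefix \<open>\<alpha>\<close> of \<open>x\<close> with \<open>n + 1\<close> edges.\<close>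

primrec cylinder_term :: "nat \<Rightarrow> (nat \<Rightarrow> 'e) \<Rightarrow> ('k::field, 'v, 'e, 'g) ep_term" where
  "cylinder_term 0 x = Mult (S_term (x 0) \<one>) (Star (S_term (x 0) \<one>))"
| "cylinder_term (Suc n) x =
    Mult (S_term (x 0) \<one>) (Mult (cylinder_term n (shift x)) (Star (S_term (x 0) \<one>)))"

lemma cylinder_term_closed [simp]:
  "x \<in> infinite_paths \<Longrightarrow> cylinder_term n x \<in> star_terms (ep_generators G E)"
  by (induction n arbitrary: x) simp_all

lemma cylinder_Suc_iff:
  assumes "x \<in> infinite_paths"
  shows "y \<in> cylinder x (Suc n) \<longleftrightarrow>
    y \<in> infinite_paths \<and> y 0 = x 0 \<and> shift y \<in> cylinder (shift x) n"
  using assms by (auto simp: cylinder_def less_Suc_eq_0_disj)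

lemma operator_cylinder_term:
  assumes "x \<in> infinite_paths"
  shows "operator True (cylinder_term n x) f = (\<lambda>y. if y \<in> cylinder x (Suc n) then f y else 0)"
  using assms
proof (induction n arbitrary: x f)
  case 0
  then show ?case
    using operator_edge_projection[of "x 0" True f]
    by (auto simp: fun_eq_iff cylinder_def simp del: eval.simps)
next
  case (Suc n)
  have star: "operator True (Star (S_term (x 0) \<one>)) f (shift y) = f y"
    if "y \<in> infinite_paths" "y 0 = x 0" for y
    using that prepend_shift[of y "x 0"] by (simp add: pullback_def)
  have "operator True (cylinder_term (Suc n) x) f y =
      (if y \<in> infinite_paths \<and> y 0 = x 0
       then operator True (cylinder_term n (shift x)) (operator True (Star (S_term (x 0) \<one>)) f) (shift y)
       else 0)" for y
    using Suc.prems by (simp add: pullback_def)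
  with Suc.prems show ?case
    by (simp only: Suc.IH[OF shift_closed] cylinder_Suc_iff[of x _ "Suc n"] fun_eq_iff)
      (use star in auto)
qed

text \<open>Sums of vertex projections are the local units of the algebra. A list keeps the term well defined
  although the addition of terms is not commutative.\<close>

definition unit_term :: "'v list \<Rightarrow> ('k::field, 'v, 'e, 'g) ep_term" where
  "unit_term vs = foldr (\<lambda>v. Add (P_term v \<one>)) vs Zero"

lemma unit_term_closed [simp]:
  "set vs \<subseteq> verts E \<Longrightarrow> unit_term vs \<in> star_terms (ep_generators G E)"
  by (induction vs) (auto simp: unit_term_def)

lemma operator_unit_term:
  assumes "distinct vs" "set vs \<subseteq> verts E"
  shows "operator b (unit_term vs) f =
    (\<lambda>x. if x \<in> infinite_paths \<and> path_range x \<in> set vs then f x else 0)"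
  using assms
proof (induction vs)
  case (Cons v vs)
  then show ?case
    using operator_vertex_projection[of v b f]
    by (auto simp: fun_eq_iff unit_term_def simp del: eval.simps(1))
qed (simp add: unit_term_def)

abbreviation ep_class :: "('k::field, 'v, 'e, 'g) ep_term \<Rightarrow> ('k, 'v, 'e, 'g) ep_term set" where
  "ep_class \<equiv> term_class (ep_generators G E) (ep_relations G E av ae \<phi>)"

lemma finsum_vertices:
  assumes "finite V" "V \<subseteq> verts E"
  shows "\<exists>vs. distinct vs \<and> set vs = V \<and>
    (\<Oplus>\<^bsub>exel_pardo_algebra G E av ae \<phi>\<^esub>v\<in>V. ep_P G E av ae \<phi> v \<one>) =
    (ep_class (unit_term vs) :: ('k::field, 'v, 'e, 'g) ep_term set)"
  using assms
proof (induction V)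
  case empty
  interpret abelian_group
    "exel_pardo_algebra G E av ae \<phi> :: ('k, 'v, 'e, 'g) ep_algebra"
    unfolding exel_pardo_algebra_def by (rule abelian_group_presented)
  show ?case
    by (simp add: unit_term_def) (simp add: exel_pardo_algebra_def)
next
  case (insert v V)
  interpret abelian_group
    "exel_pardo_algebra G E av ae \<phi> :: ('k, 'v, 'e, 'g) ep_algebra"
    unfolding exel_pardo_algebra_def by (rule abelian_group_presented)
  obtain vs where vs: "distinct vs" "set vs = V"
    "(\<Oplus>\<^bsub>exel_pardo_algebra G E av ae \<phi>\<^esub>v\<in>V. ep_P G E av ae \<phi> v \<one>) =
      (ep_class (unit_term vs) :: ('k, 'v, 'e, 'g) ep_term set)"
    using insert by auto
  have P: "ep_P G E av ae \<phi> w \<one> = (ep_class (P_term w \<one>) :: ('k, 'v, 'e, 'g) ep_term set)" for w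
    by (simp add: ep_P_def term_class_def)
  have "(\<Oplus>\<^bsub>exel_pardo_algebra G E av ae \<phi>\<^esub>v\<in>insert v V. ep_P G E av ae \<phi> v \<one>) =
      ep_class (P_term v \<one>) \<oplus>\<^bsub>exel_pardo_algebra G E av ae \<phi>\<^esub>
      (ep_class (unit_term vs) :: ('k, 'v, 'e, 'g) ep_term set)"
    using insert vs by (subst finsum_insert) (auto simp: P exel_pardo_algebra_def)
  also have "\<dots> = ep_class (unit_term (v # vs))"
    using insert vs by (simp add: exel_pardo_algebra_def unit_term_def[of "v # vs"]
        unit_term_def[of vs, symmetric])
  finally show ?case
    using insert vs by (intro exI[of _ "v # vs"]) auto
qed

section \<open>The center of a simple algebra\<close>

text \<open>A simple algebra has a nonzero product by definition, whereas a graph without vertices has the zero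
  algebra.\<close>

lemma vertex_exists:
  assumes "simple_algebra (exel_pardo_algebra G E av ae \<phi> :: ('k::field, 'v, 'e, 'g) ep_algebra)"
  shows "verts E \<noteq> {}"
proof
  assume "verts E = {}"
  then have "ep_generators G E = {}"
    using tail_in_verts by (auto simp: ep_generators_def)
  then have zero: "ep_class t = ep_class Zero"
    if "t \<in> star_terms (ep_generators G E)" for t :: "('k, 'v, 'e, 'g) ep_term"
    using that star_congruence_Zero by (simp add: term_class_eq_iff)
  obtain t u :: "('k, 'v, 'e, 'g) ep_term"
    where "t \<in> star_terms (ep_generators G E)" "u \<in> star_terms (ep_generators G E)"
      "ep_class (Mult t u) \<noteq> ep_class Zero"
    using assms by (auto simp: simple_algebra_def exel_pardo_algebra_def)
  with zero[of "Mult t u"] show False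
    by simp
qed

text \<open>The kernel of the representation is a two-sided ideal. It does not contain \<open>p\<^sub>v\<close>, which fixes the value of
  the constant function \<open>1\<close> at an infinite path with range \<open>v\<close>. Hence it is zero if the algebra is simple.\<close>

lemma representation_faithful:
  fixes t u :: "('k::field, 'v, 'e, 'g) ep_term"
  assumes "no_sources E"
    and simple: "simple_algebra (exel_pardo_algebra G E av ae \<phi> :: ('k, 'v, 'e, 'g) ep_algebra)"
    and t: "t \<in> star_terms (ep_generators G E)" and u: "u \<in> star_terms (ep_generators G E)"
    and eq: "operator True t = operator True u"
  shows "ep_class t = ep_class u"
proof -
  let ?L = "exel_pardo_algebra G E av ae \<phi> :: ('k, 'v, 'e, 'g) ep_algebra"
  interpret L: abelian_group ?L
    unfolding exel_pardo_algebra_def by (rule abelian_group_presented)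
  define J where "J = {s \<in> star_terms (ep_generators G E).
    \<forall>f. operator True s f = (\<lambda>_. 0 :: 'k)}"
  have "two_sided_ideal (ep_class ` J) ?L"
    unfolding exel_pardo_algebra_def
    by (rule two_sided_ideal_term_classes) (auto simp: J_def eval_zero)
  with simple have "ep_class ` J = {\<zero>\<^bsub>?L\<^esub>} \<or> ep_class ` J = carrier ?L"
    by (simp add: simple_algebra_def)
  moreover have "ep_class ` J \<noteq> carrier ?L"
  proof
    assume J: "ep_class ` J = carrier ?L"
    obtain v x where v: "v \<in> verts E" "x \<in> infinite_paths" "path_range x = v"
      using vertex_exists[OF simple] infinite_path_exists[OF assms(1)] by blast
    then have "ep_class (P_term v \<one>) \<in> ep_class ` J"
      unfolding J by (simp add: exel_pardo_algebra_def)
    then obtain s where "s \<in> J" "ep_class (P_term v \<one>) = ep_class s"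
      by blast
    with v have "operator True (P_term v \<one>) = operator True s"
      using operator_respects_ep_congruence by (simp add: J_def term_class_eq_iff)
    with \<open>s \<in> J\<close> have "operator True (P_term v \<one>) (\<lambda>_. 1) x = (0 :: 'k)"
      by (simp add: J_def)
    with v show False
      using operator_vertex_projection[of v True "\<lambda>_. 1 :: 'k"] by (simp del: eval.simps)
  qed
  moreover have "Add t (Smult (- 1) u) \<in> J"
    using t u eq by (simp add: J_def)
  ultimately have "ep_class (Add t (Smult (- 1) u)) = \<zero>\<^bsub>?L\<^esub>"
    by blast
  then have "ep_class t \<oplus>\<^bsub>?L\<^esub> (\<ominus>\<^bsub>?L\<^esub> ep_class u) = \<zero>\<^bsub>?L\<^esub>"
    using t u by (simp add: exel_pardo_algebra_def uminus_presented)
  moreover have "ep_class t \<in> carrier ?L" "ep_class u \<in> carrier ?L"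
    using t u by (simp_all add: exel_pardo_algebra_def)
  ultimately show ?thesis
    using L.minus_equality L.minus_minus L.a_inv_closed by metis
qed

text \<open>On the projection \<open>q\<close> onto a suitable cylinder, \<open>t\<close> acts as a scalar \<open>c\<close>: inside the cylinder by
  \<open>local_operator_scalar_on_cylinder\<close>, and outside because \<open>t q = q t\<close> vanishes there. The elements \<open>u\<close>
  with \<open>t u = c u\<close> form a two-sided ideal since \<open>t\<close> is central, so by simplicity they are all elements.\<close>

lemma central_acts_as_scalar:
  fixes t :: "('k::field, 'v, 'e, 'g) ep_term"
  assumes "no_sources E"
    and simple: "simple_algebra (exel_pardo_algebra G E av ae \<phi> :: ('k, 'v, 'e, 'g) ep_algebra)"
    and t: "t \<in> star_terms (ep_generators G E)"
    and central: "ep_class t \<in> center (exel_pardo_algebra G E av ae \<phi>)"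
  obtains c where "\<And>u f. u \<in> star_terms (ep_generators G E) \<Longrightarrow>
    operator True t (operator True u f) = (\<lambda>x. c * operator True u f x)"
proof -
  let ?L = "exel_pardo_algebra G E av ae \<phi> :: ('k, 'v, 'e, 'g) ep_algebra"
  have commute: "operator True t (operator True u f) = operator True u (operator True t f)"
    if u: "u \<in> star_terms (ep_generators G E)" for u f
  proof -
    have "ep_class (Mult t u) = ep_class (Mult u t)"
      using central t u by (auto simp: center_def exel_pardo_algebra_def)
    with t u have "operator True (Mult t u) = operator True (Mult u t)"
      using operator_respects_ep_congruence by (simp add: term_class_eq_iff)
    then show ?thesis
      by (metis (full_types) eval.simps(5))
  qed
  \<comment> \<open>Starting from a cylinder of length \<open>1\<close> makes \<open>m\<close> positive, as \<open>operator_cylinder_term\<close> requires.\<close>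
  obtain x0 where "x0 \<in> infinite_paths"
    using vertex_exists[OF simple] infinite_path_exists[OF assms(1)] by blast
  then obtain x m c where x: "x \<in> infinite_paths" and m: "m \<ge> 1"
    and scalar: "\<And>f z. \<lbrakk>\<forall>z. z \<notin> cylinder x m \<longrightarrow> f z = 0; z \<in> cylinder x m\<rbrakk> \<Longrightarrow>
      operator True t f z = c * f z"
    using local_operator_scalar_on_cylinder[OF local_operator_term[OF t], of x0 1 True]
      cylinder_infinite_path by metis
  obtain n where "m = Suc n"
    using m by (cases m) auto
  define q where "q = (cylinder_term n x :: ('k, 'v, 'e, 'g) ep_term)"
  have q_closed: "q \<in> star_terms (ep_generators G E)"
    using x by (simp add: q_def)
  have q: "operator True q f = (\<lambda>y. if y \<in> cylinder x m then f y else 0)" for f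
    using operator_cylinder_term[OF x] by (simp add: q_def \<open>m = Suc n\<close>)
  define J where "J = {u \<in> star_terms (ep_generators G E).
    \<forall>f. operator True t (operator True u f) = (\<lambda>x. c * operator True u f x)}"
  have "two_sided_ideal (ep_class ` J) ?L"
    unfolding exel_pardo_algebra_def
  proof (rule two_sided_ideal_term_classes)
    fix u w :: "('k, 'v, 'e, 'g) ep_term"
    assume u: "u \<in> J" and w: "w \<in> star_terms (ep_generators G E)"
    then have "operator True t (operator True w (operator True u f)) =
        (\<lambda>x. c * operator True w (operator True u f) x)" for f
      by (simp add: commute[OF w] J_def eval_scale)
    with u w show "Mult u w \<in> J \<and> Mult w u \<in> J"
      by (simp add: J_def)
  qed (auto simp: J_def eval_zero eval_add eval_scale algebra_simps)
  with simple have J_cases: "ep_class ` J = {\<zero>\<^bsub>?L\<^esub>} \<or> ep_class ` J = carrier ?L"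
    by (simp add: simple_algebra_def)
  have "operator True t (operator True q f) z = c * operator True q f z" for f z
  proof (cases "z \<in> cylinder x m")
    case True
    then show ?thesis
      by (intro scalar) (simp_all add: q)
  next
    case False
    have "operator True t (operator True q f) z = operator True q (operator True t f) z"
      by (simp only: commute[OF q_closed])
    with False show ?thesis
      by (simp add: q)
  qed
  then have "q \<in> J"
    using q_closed by (simp add: J_def fun_eq_iff)
  moreover have "ep_class q \<noteq> \<zero>\<^bsub>?L\<^esub>"
  proof
    assume "ep_class q = \<zero>\<^bsub>?L\<^esub>"
    then have "operator True q = operator True (Zero :: ('k, 'v, 'e, 'g) ep_term)"
      using q_closed operator_respects_ep_congruence
      by (simp add: exel_pardo_algebra_def term_class_eq_iff)
    then have "operator True q (\<lambda>_. 1) x = (0 :: 'k)"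
      by simp
    with x show False
      by (simp add: q cylinder_self)
  qed
  ultimately have J: "ep_class ` J = carrier ?L"
    using J_cases by blast
  have "operator True t (operator True u f) = (\<lambda>x. c * operator True u f x)"
    if u: "u \<in> star_terms (ep_generators G E)" for u f
  proof -
    have "ep_class u \<in> ep_class ` J"
      unfolding J using u by (simp add: exel_pardo_algebra_def)
    then obtain w where w: "w \<in> J" "ep_class u = ep_class w"
      by blast
    with u have "operator True u = operator True w"
      using operator_respects_ep_congruence by (simp add: J_def term_class_eq_iff)
    with w show ?thesis
      by (simp add: J_def)
  qed
  with that show ?thesis
    by blast
qed

text \<open>The sum of all vertex projections acts as the identity on the range of every operator of the algebra, so
  faithfulness makes it the identity of the algebra, and \<open>t = t \<cdot> 1 = c \<cdot> 1\<close>.\<close>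

lemma center_unital:
  assumes "no_sources E"
    and simple: "simple_algebra (exel_pardo_algebra G E av ae \<phi> :: ('k::field, 'v, 'e, 'g) ep_algebra)"
    and "finite (verts E)"
  shows "center (exel_pardo_algebra G E av ae \<phi>) =
    {a \<odot>\<^bsub>exel_pardo_algebra G E av ae \<phi>\<^esub> ep_one G E av ae \<phi> | a :: 'k. True}"
proof -
  let ?L = "exel_pardo_algebra G E av ae \<phi> :: ('k, 'v, 'e, 'g) ep_algebra"
  obtain vs where vs: "distinct vs" "set vs = verts E"
    "ep_one G E av ae \<phi> = (ep_class (unit_term vs) :: ('k, 'v, 'e, 'g) ep_term set)"
    using finsum_vertices[OF assms(3)] by (auto simp: ep_one_def)
  define i where "i = (unit_term vs :: ('k, 'v, 'e, 'g) ep_term)"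
  have i_closed: "i \<in> star_terms (ep_generators G E)"
    using vs by (simp add: i_def)
  have i: "operator True i f = (\<lambda>x. if x \<in> infinite_paths then f x else 0)" for f
    using vs by (auto simp: i_def operator_unit_term)
  have smult_one: "a \<odot>\<^bsub>?L\<^esub> ep_one G E av ae \<phi> = ep_class (Smult a i)" for a
    using i_closed by (simp add: exel_pardo_algebra_def vs i_def)
  have right_unit: "operator True t (operator True i f) = operator True t f"
    if t: "t \<in> star_terms (ep_generators G E)" for t f
  proof -
    obtain F where "source_in F (operator True t)"
      using operator_finite_source[OF t] by blast
    then show ?thesis
      by (rule source_inD) (simp add: i)
  qed
  have left_unit: "operator True i (operator True t f) = operator True t f"
    if t: "t \<in> star_terms (ep_generators G E)" for t f
    using operator_outside[OF t] by (auto simp: i)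
  show ?thesis
  proof
    show "center ?L \<subseteq> {a \<odot>\<^bsub>?L\<^esub> ep_one G E av ae \<phi> | a. True}"
    proof
      fix z assume z: "z \<in> center ?L"
      then obtain t where t: "t \<in> star_terms (ep_generators G E)" "z = ep_class t"
        by (auto simp: center_def exel_pardo_algebra_def)
      then obtain c where c: "\<And>u f. u \<in> star_terms (ep_generators G E) \<Longrightarrow>
          operator True t (operator True u f) = (\<lambda>x. c * operator True u f x)"
        using central_acts_as_scalar[OF assms(1) simple] z by metis
      have "operator True t f = operator True (Smult c i) f" for f
        using right_unit[OF t(1), of f] c[OF i_closed, of f] by simp
      then have "ep_class t = ep_class (Smult c i)"
        using representation_faithful[OF assms(1) simple t(1)] i_closed by (simp add: ext)
      with t(2) smult_one show "z \<in> {a \<odot>\<^bsub>?L\<^esub> ep_one G E av ae \<phi> | a. True}"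
        by auto
    qed
    show "{a \<odot>\<^bsub>?L\<^esub> ep_one G E av ae \<phi> | a. True} \<subseteq> center ?L"
    proof
      fix z assume "z \<in> {a \<odot>\<^bsub>?L\<^esub> ep_one G E av ae \<phi> | a. True}"
      then obtain a where z: "z = ep_class (Smult a i)"
        using smult_one by auto
      have "ep_class (Mult (Smult a i) u) = ep_class (Mult u (Smult a i))"
        if u: "u \<in> star_terms (ep_generators G E)" for u
      proof (rule representation_faithful[OF assms(1) simple])
        show "operator True (Mult (Smult a i) u) = operator True (Mult u (Smult a i))"
          by (rule ext) (simp add: eval_scale left_unit[OF u] right_unit[OF u])
      qed (use u i_closed in simp_all)
      then show "z \<in> center ?L"
        using i_closed by (auto simp: z center_def exel_pardo_algebra_def)
    qed
  qed
qed

text \<open>A central \<open>t\<close> satisfies \<open>t p\<^sub>w = c p\<^sub>w\<close> for all \<open>w\<close>, but \<open>t p\<^sub>w = 0\<close> for \<open>w\<close> outside a finite set \<open>F\<close>. Since the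
  vertices are not exhausted by \<open>F\<close>, it follows that \<open>c = 0\<close>; so \<open>t = t e = 0\<close> for the local unit \<open>e\<close>
  of \<open>F\<close>.\<close>

lemma center_nonunital:
  assumes "no_sources E"
    and simple: "simple_algebra (exel_pardo_algebra G E av ae \<phi> :: ('k::field, 'v, 'e, 'g) ep_algebra)"
    and "infinite (verts E)"
  shows "center (exel_pardo_algebra G E av ae \<phi>) =
    {\<zero>\<^bsub>exel_pardo_algebra G E av ae \<phi> :: ('k, 'v, 'e, 'g) ep_algebra\<^esub>}"
proof -
  let ?L = "exel_pardo_algebra G E av ae \<phi> :: ('k, 'v, 'e, 'g) ep_algebra"
  have "z = \<zero>\<^bsub>?L\<^esub>" if z: "z \<in> center ?L" for z
  proof -
    obtain t where t: "t \<in> star_terms (ep_generators G E)" "z = ep_class t"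
      using z by (auto simp: center_def exel_pardo_algebra_def)
    then obtain c where c: "\<And>u f. u \<in> star_terms (ep_generators G E) \<Longrightarrow>
        operator True t (operator True u f) = (\<lambda>x. c * operator True u f x)"
      using central_acts_as_scalar[OF assms(1) simple] z by metis
    obtain F where F: "finite F" "F \<subseteq> verts E" "source_in F (operator True t)"
      using operator_finite_source[OF t(1)] by blast
    obtain w where w: "w \<in> verts E" "w \<notin> F"
      using F(1) assms(3) by (meson finite_subset subsetI)
    obtain x where x: "x \<in> infinite_paths" "path_range x = w"
      using infinite_path_exists[OF assms(1) w(1)] by blast
    have P: "operator True (P_term w \<one>) (\<lambda>_. 1 :: 'k) =
        (\<lambda>x. if x \<in> infinite_paths \<and> path_range x = w then 1 else 0)"
      using operator_vertex_projection[OF w(1)] by simp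
    have "operator True t (operator True (P_term w \<one>) (\<lambda>_. 1)) = operator True t (\<lambda>_. 0)"
      using w(2) by (intro source_inD[OF F(3)]) (auto simp only: P split: if_splits)
    moreover have "operator True t (operator True (P_term w \<one>) (\<lambda>_. 1)) x = c"
    proof -
      have "operator True t (operator True (P_term w \<one>) (\<lambda>_. 1)) x =
          c * operator True (P_term w \<one>) (\<lambda>_. 1) x"
        using w(1) by (intro fun_cong[OF c]) simp
      also have "operator True (P_term w \<one>) (\<lambda>_. 1 :: 'k) x = 1"
        using x by (simp only: P) simp
      finally show ?thesis
        by simp
    qed
    ultimately have "c = 0"
      by (simp add: eval_zero)
    obtain vs where vs: "distinct vs" "set vs = F"
      using F(1) finite_distinct_list by blast
    have "operator True t f = operator True t (operator True (unit_term vs) f)" for f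
      using vs F(2) by (intro source_inD[OF F(3)]) (simp add: operator_unit_term)
    also have "\<dots> f = (\<lambda>_. 0)" for f
      using c[of "unit_term vs"] vs F(2) \<open>c = 0\<close> by simp
    finally have "operator True t = operator True Zero"
      by (intro ext) simp
    then have "ep_class t = ep_class Zero"
      using representation_faithful[OF assms(1) simple t(1)] by simp
    with t(2) show ?thesis
      by (simp add: exel_pardo_algebra_def)
  qed
  moreover have "\<zero>\<^bsub>?L\<^esub> \<in> center ?L"
  proof -
    have "ep_class (Mult Zero u) = ep_class (Mult u Zero)"
      if u: "u \<in> star_terms (ep_generators G E)" for u :: "('k, 'v, 'e, 'g) ep_term"
      using u by (intro representation_faithful[OF assms(1) simple]) (auto simp: eval_zero)
    then show ?thesis
      by (auto simp: center_def exel_pardo_algebra_def)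
  qed
  ultimately show ?thesis
    by blast
qed

end

theorem theorem5p6:
  fixes G :: "('g, 'm) monoid_scheme"
    and E :: "('v, 'e) pre_digraph"
    and av :: "'g \<Rightarrow> 'v \<Rightarrow> 'v"
    and ae :: "'g \<Rightarrow> 'e \<Rightarrow> 'e"
    and \<phi> :: "'g \<Rightarrow> 'e \<Rightarrow> 'g"
    and L :: "('k::field, 'v, 'e, 'g) ep_algebra"
  assumes "graph_action G E av ae"
    and "countable (carrier G)"
    and "row_finite E"
    and "no_sources E"
    and "one_cocycle G (arcs E) ae \<phi>"
    and "\<And>g e v. \<lbrakk>g \<in> carrier G; e \<in> arcs E; v \<in> verts E\<rbrakk> \<Longrightarrow> av (\<phi> g e) v = av g v"
    and "\<And>g v. \<lbrakk>g \<in> carrier G; v \<in> verts E\<rbrakk> \<Longrightarrow>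
           finite {p. minimal_strongly_fixed G E av ae \<phi> g p \<and> fst p = v}"
    and "L = exel_pardo_algebra G E av ae \<phi>"
  shows "(finite (verts E) \<and> simple_algebra L \<longrightarrow>
            center L = {a \<odot>\<^bsub>L\<^esub> ep_one G E av ae \<phi> | a. True}) \<and>
         (infinite (verts E) \<and> simple_algebra L \<longrightarrow> center L = {\<zero>\<^bsub>L\<^esub>})"
proof -
  interpret self_similar_action G E av ae \<phi>
    using assms(1,5,6) by (intro self_similar_action.intro self_similar_action_axioms.intro)
  show ?thesis
    unfolding assms(8) using center_unital[OF assms(4)] center_nonunital[OF assms(4)] by blast
qed

end
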